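(* Let $\alpha>-1$, $i\in\mathbb{S}$, let $J$ be the unitary anti-selfadjoint operator $Jf=\operatorname{ext}(if_i)$ on $\mathcal{A}^2_{\alpha,i}(\mathbb{D})$, and let $T\in\mathcal{B}_J(\mathcal{A}^2_{\alpha,i}(\mathbb{D}))$. Then $$|\widetilde{T}(z)-\widetilde{T}(w)|\le 2\sqrt{2+\alpha}\,\|T\|\,\beta(z,w)\quad\text{for all }z,w\in\mathbb{D}_i,$$ where $$\beta(z,w)=\frac12\log\frac{1+\rho(z,w)}{1-\rho(z,w)},\qquad \rho(z,w)=\frac{|z-w|}{|1-z\overline{w}|},$$ $\beta$ being the Bergman metric on $\mathbb{D}_i$. Furthermore, the Lipschitz constant $2\sqrt{2+\alpha}$ is sharp, i.e. it cannot be replaced by a smaller constant valid for all $T\in\mathcal{B}_J(\mathcal{A}^2_{\alpha,i}(\mathbb{D}))$ and all $z,w\in\mathbb{D}_i$.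
   Context: $\mathbb{H}$ denotes the quaternions, $\mathbb{D}$ its open unit ball, $\mathbb{S}=\{x\in\mathbb{H}:\operatorname{Re}(x)=0,\ |x|=1\}$, $\mathbb{C}_i=\{a+ib:a,b\in\mathbb{R}\}$, $\mathbb{D}_i=\mathbb{D}\cap\mathbb{C}_i$, and $dm_i$ is Lebesgue measure on $\mathbb{C}_i$. Every $x\in\mathbb{H}$ is written $x=x_0+i_xx_1$ with $x_0=\operatorname{Re}(x)$, $x_1$ the modulus of the imaginary part, $i_x\in\mathbb{S}$. A real differentiable $f:\mathbb{D}\to\mathbb{H}$ is left slice hyperholomorphic if $f(x)=u(x_0,x_1)+i_xv(x_0,x_1)$ with $\mathbb{H}$-valued $u,v$ satisfying $u(x_0,x_1)=u(x_0,-x_1)$, $v(x_0,x_1)=-v(x_0,-x_1)$, $\partial_{x_0}u=\partial_{x_1}v$ and $\partial_{x_0}v=-\partial_{x_1}u$. $dA_{\alpha,i}(z)=\frac{\alpha+1}{\pi}(1-|z|^2)^\alpha dm_i(z)$ on $\mathbb{D}_i$. $\mathcal{A}^2_{\alpha,i}(\mathbb{D})$ is the right $\mathbb{H}$-vector space of all left slice hyperholomorphic $f$ on $\mathbb{D}$ with $\int_{\mathbb{D}_i}|f|^2dA_{\alpha,i}<\infty$, with scalar product $\langle f,g\rangle=\int_{\mathbb{D}_i}\overline{f(z)}g(z)\,dA_{\alpha,i}(z)$; it is a quaternionic reproducing kernel Hilbert space. $K_w$ denotes the unique element with $f(w)=\langle K_w,f\rangle$ for all $f$ (for $z,w\in\mathbb{D}_i$,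 $K_w(z)=(1-z\overline w)^{-(2+\alpha)}$), $k_w=K_w/\|K_w\|$, and the Berezin transform of $T$ is $\widetilde{T}(z)=\langle k_z,Tk_z\rangle$, $z\in\mathbb{D}_i$. $f_i=f|_{\mathbb{D}_i}$, and $\operatorname{ext}(if_i)$ is the unique left slice hyperholomorphic function on $\mathbb{D}$ whose restriction to $\mathbb{D}_i$ is $z\mapsto if(z)$. $\mathcal{B}_J(\mathcal{A}^2_{\alpha,i}(\mathbb{D}))$ is the set of bounded right $\mathbb{H}$-linear operators commuting with $J$, and $\|T\|$ is the operator norm. *)

theory Defs
  imports "HOL-Analysis.Analysis"
begin

section \<open>Quaternions\<close>

datatype quat = Quat (qRe: real) (qI: real) (qJ: real) (qK: real)

lemma quat_eqI:
  "\<lbrakk>qRe x = qRe y; qI x = qI y; qJ x = qJ y; qK x = qK y\<rbrakk> \<Longrightarrow> x = y"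
  by (rule quat.expand) auto

lemma quat_eq_iff:
  "x = y \<longleftrightarrow> qRe x = qRe y \<and> qI x = qI y \<and> qJ x = qJ y \<and> qK x = qK y"
  by (auto intro: quat_eqI)

instantiation quat :: ab_group_add
begin

definition "0 = Quat 0 0 0 0"
definition "x + y = Quat (qRe x + qRe y) (qI x + qI y) (qJ x + qJ y) (qK x + qK y)"
definition "x - y = Quat (qRe x - qRe y) (qI x - qI y) (qJ x - qJ y) (qK x - qK y)"
definition "- x = Quat (- qRe x) (- qI x) (- qJ x) (- qK x)"

instance
  by standard (simp_all add: quat_eq_iff zero_quat_def plus_quat_def minus_quat_def uminus_quat_def)

end

lemma quat_add_sel [simp]:
  "qRe 0 = 0" "qI 0 = 0" "qJ 0 = 0" "qK 0 = 0"
  "qRe (x + y) = qRe x + qRe y" "qI (x + y) = qI x + qI y"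
  "qJ (x + y) = qJ x + qJ y" "qK (x + y) = qK x + qK y"
  "qRe (x - y) = qRe x - qRe y" "qI (x - y) = qI x - qI y"
  "qJ (x - y) = qJ x - qJ y" "qK (x - y) = qK x - qK y"
  "qRe (- x) = - qRe x" "qI (- x) = - qI x" "qJ (- x) = - qJ x" "qK (- x) = - qK x"
  by (simp_all add: zero_quat_def plus_quat_def minus_quat_def uminus_quat_def)

instantiation quat :: ring_1
begin

definition "1 = Quat 1 0 0 0"
definition "x * y = Quat
  (qRe x * qRe y - qI x * qI y - qJ x * qJ y - qK x * qK y)
  (qRe x * qI y + qI x * qRe y + qJ x * qK y - qK x * qJ y)
  (qRe x * qJ y - qI x * qK y + qJ x * qRe y + qK x * qI y)
  (qRe x * qK y + qI x * qJ y - qJ x * qI y + qK x * qRe y)"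

instance
  by standard (simp_all add: quat_eq_iff one_quat_def times_quat_def algebra_simps)

end

lemma quat_mult_sel [simp]:
  "qRe 1 = 1" "qI 1 = 0" "qJ 1 = 0" "qK 1 = 0"
  "qRe (x * y) = qRe x * qRe y - qI x * qI y - qJ x * qJ y - qK x * qK y"
  "qI (x * y) = qRe x * qI y + qI x * qRe y + qJ x * qK y - qK x * qJ y"
  "qJ (x * y) = qRe x * qJ y - qI x * qK y + qJ x * qRe y + qK x * qI y"
  "qK (x * y) = qRe x * qK y + qI x * qJ y - qJ x * qI y + qK x * qRe y"
  by (simp_all add: one_quat_def times_quat_def)

instantiation quat :: real_algebra_1
begin

definition "r *\<^sub>R x = Quat (r * qRe x) (r * qI x) (r * qJ x) (r * qK x)"

instance
  by standard (simp_all add: quat_eq_iff scaleR_quat_def algebra_simps)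

end

lemma quat_scaleR_sel [simp]:
  "qRe (r *\<^sub>R x) = r * qRe x" "qI (r *\<^sub>R x) = r * qI x"
  "qJ (r *\<^sub>R x) = r * qJ x" "qK (r *\<^sub>R x) = r * qK x"
  by (simp_all add: scaleR_quat_def)

definition qcnj :: "quat \<Rightarrow> quat" where
  "qcnj x = Quat (qRe x) (- qI x) (- qJ x) (- qK x)"

lemma qcnj_sel [simp]:
  "qRe (qcnj x) = qRe x" "qI (qcnj x) = - qI x" "qJ (qcnj x) = - qJ x" "qK (qcnj x) = - qK x"
  by (simp_all add: qcnj_def)

instantiation quat :: real_inner
begin

definition "inner_quat x y = qRe x * qRe y + qI x * qI y + qJ x * qJ y + qK x * qK y"
definition "norm_quat (x :: quat) = sqrt (x \<bullet> x)"
definition "sgn_quat (x :: quat) = x /\<^sub>R norm x"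
definition "dist_quat (x :: quat) y = norm (x - y)"
definition "(uniformity :: (quat \<times> quat) filter) = (INF e\<in>{0<..}. principal {(x, y). dist x y < e})"
definition "open (U :: quat set) \<longleftrightarrow> (\<forall>x\<in>U. \<forall>\<^sub>F (x', y) in uniformity. x' = x \<longrightarrow> y \<in> U)"

instance
proof
  fix x y z :: quat and r :: real
  show "dist x y = norm (x - y)"
    by (simp add: dist_quat_def)
  show "sgn x = x /\<^sub>R norm x"
    by (simp add: sgn_quat_def)
  show "uniformity = (INF e\<in>{0<..}. principal {(x, y :: quat). dist x y < e})"
    by (simp add: uniformity_quat_def)
  show "open U \<longleftrightarrow> (\<forall>x\<in>U. \<forall>\<^sub>F (x', y) in uniformity. x' = x \<longrightarrow> y \<in> U)" for U :: "quat set"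
    by (simp add: open_quat_def)
  show "x \<bullet> y = y \<bullet> x"
    by (simp add: inner_quat_def mult.commute)
  show "(x + y) \<bullet> z = x \<bullet> z + y \<bullet> z"
    by (simp add: inner_quat_def algebra_simps)
  show "(r *\<^sub>R x) \<bullet> y = r * (x \<bullet> y)"
    by (simp add: inner_quat_def algebra_simps)
  show "0 \<le> x \<bullet> x"
    by (simp add: inner_quat_def)
  show "x \<bullet> x = 0 \<longleftrightarrow> x = 0"
  proof
    assume "x \<bullet> x = 0"
    then have "(qRe x)\<^sup>2 + (qI x)\<^sup>2 + (qJ x)\<^sup>2 + (qK x)\<^sup>2 = 0"
      by (simp add: inner_quat_def power2_eq_square)
    then have "(qRe x)\<^sup>2 = 0 \<and> (qI x)\<^sup>2 = 0 \<and> (qJ x)\<^sup>2 = 0 \<and> (qK x)\<^sup>2 = 0"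
      using zero_le_power2[of "qRe x"] zero_le_power2[of "qI x"]
        zero_le_power2[of "qJ x"] zero_le_power2[of "qK x"] by linarith
    then show "x = 0"
      by (simp add: quat_eq_iff)
  qed (simp add: inner_quat_def)
  show "norm x = sqrt (x \<bullet> x)"
    by (simp add: norm_quat_def)
qed

end

lemma norm_quat_eq: "norm x = sqrt ((qRe x)\<^sup>2 + (qI x)\<^sup>2 + (qJ x)\<^sup>2 + (qK x)\<^sup>2)"
  by (simp add: norm_quat_def inner_quat_def power2_eq_square)

lemma qcnj_mult: "qcnj (x * y) = qcnj y * qcnj x"
  by (simp add: quat_eq_iff algebra_simps)

lemma mult_qcnj: "x * qcnj x = (norm x)\<^sup>2 *\<^sub>R 1" "qcnj x * x = (norm x)\<^sup>2 *\<^sub>R 1"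
proof -
  have sq: "(norm x)\<^sup>2 = qRe x * qRe x + qI x * qI x + qJ x * qJ x + qK x * qK x"
    by (simp add: norm_quat_eq power2_eq_square)
  show "x * qcnj x = (norm x)\<^sup>2 *\<^sub>R 1" "qcnj x * x = (norm x)\<^sup>2 *\<^sub>R 1"
    unfolding sq by (simp_all add: quat_eq_iff algebra_simps)
qed

instantiation quat :: real_normed_div_algebra
begin

definition "inverse_quat (x :: quat) = qcnj x /\<^sub>R (norm x)\<^sup>2"
definition "divide_quat (x :: quat) y = x * inverse y"

instance
proof
  fix x y :: quat
  show "inverse x * x = 1" "x * inverse x = 1" if "x \<noteq> 0"
    using that by (simp_all add: inverse_quat_def mult_qcnj)
  show "x div y = x * inverse y"
    by (simp add: divide_quat_def)
  show "inverse (0 :: quat) = 0"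
    by (simp add: inverse_quat_def quat_eq_iff)
  have "(norm (x * y))\<^sup>2 *\<^sub>R 1 = x * (y * qcnj y) * qcnj x"
    by (simp only: mult_qcnj(1)[symmetric] qcnj_mult mult.assoc)
  also have "\<dots> = (norm y)\<^sup>2 *\<^sub>R (x * qcnj x)"
    by (simp add: mult_qcnj(1)[of y])
  also have "\<dots> = (norm x * norm y)\<^sup>2 *\<^sub>R 1"
    by (simp add: mult_qcnj(1)[of x] power_mult_distrib mult.commute)
  finally have "(norm (x * y))\<^sup>2 = (norm x * norm y)\<^sup>2"
    by (simp add: quat_eq_iff)
  then show "norm (x * y) = norm x * norm y"
    by (simp add: power2_eq_iff_nonneg)
qed

end

instantiation quat :: euclidean_space
begin

definition "Basis = {Quat 1 0 0 0, Quat 0 1 0 0, Quat 0 0 1 0, Quat 0 0 0 1}"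

instance
proof
  show "(Basis :: quat set) \<noteq> {}" "finite (Basis :: quat set)"
    by (simp_all add: Basis_quat_def)
  show "u \<bullet> v = (if u = v then 1 else 0)"
    if "u \<in> Basis" "v \<in> Basis" for u v :: quat
    using that unfolding Basis_quat_def by (elim insertE emptyE) (simp_all add: inner_quat_def)
  show "(\<forall>u\<in>Basis. x \<bullet> u = 0) \<longleftrightarrow> x = 0" for x :: quat
    by (simp add: Basis_quat_def inner_quat_def) (simp add: quat_eq_iff)
qed

end

section \<open>Slices and slice hyperholomorphic functions\<close>

definition imag_units :: "quat set" where
  "imag_units = {x. qRe x = 0 \<and> norm x = 1}"

definition qIm_norm :: "quat \<Rightarrow> real" where
  "qIm_norm x = norm (x - of_real (qRe x))"

definition slice_plane :: "quat \<Rightarrow> quat set" where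
  "slice_plane i = {of_real a + i * of_real b | a b. True}"

definition slice_disc :: "quat \<Rightarrow> quat set" where
  "slice_disc i = ball 0 1 \<inter> slice_plane i"

text \<open>
  The functions u and v live on the unit disc of the plane.  For real x the unit
  playing the role of \<open>i\<^sub>x\<close> is arbitrary; this is harmless since v vanishes on the real axis.
\<close>

definition slice_hyperholomorphic :: "(quat \<Rightarrow> quat) \<Rightarrow> bool" where
  "slice_hyperholomorphic f \<longleftrightarrow>
     f differentiable_on ball 0 1 \<and>
     (\<exists>u v :: real \<Rightarrow> real \<Rightarrow> quat.
        (\<forall>x\<in>ball 0 1. \<forall>j\<in>imag_units. x = of_real (qRe x) + j * of_real (qIm_norm x) \<longrightarrow>
           f x = u (qRe x) (qIm_norm x) + j * v (qRe x) (qIm_norm x)) \<and>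
        (\<forall>a b. a\<^sup>2 + b\<^sup>2 < 1 \<longrightarrow>
           u a b = u a (- b) \<and> v a b = - v a (- b) \<and>
           (\<exists>p q. ((\<lambda>s. u s b) has_vector_derivative p) (at a) \<and>
                  ((\<lambda>t. v a t) has_vector_derivative p) (at b) \<and>
                  ((\<lambda>s. v s b) has_vector_derivative q) (at a) \<and>
                  ((\<lambda>t. u a t) has_vector_derivative - q) (at b))))"

text \<open>
  A function on the open unit ball is represented by its extension by zero, so that equality of
  functions on the ball is equality in HOL and the pointwise operations preserve the carrier.
\<close>

definition slice_regular_space :: "(quat \<Rightarrow> quat) set" where
  "slice_regular_space = {f. slice_hyperholomorphic f \<and> (\<forall>x. x \<notin> ball 0 1 \<longrightarrow> f x = 0)}"

definition slice_ext :: "quat \<Rightarrow> (quat \<Rightarrow> quat) \<Rightarrow> quat \<Rightarrow> quat" where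
  "slice_ext i g = (THE h. h \<in> slice_regular_space \<and> (\<forall>z\<in>slice_disc i. h z = g z))"

section \<open>The weighted slice Bergman space\<close>

definition slice_lebesgue :: "quat \<Rightarrow> quat measure" where
  "slice_lebesgue i =
     distr (lborel :: complex measure) borel (\<lambda>\<zeta>. of_real (Re \<zeta>) + i * of_real (Im \<zeta>))"

definition bergman_measure :: "real \<Rightarrow> quat \<Rightarrow> quat measure" where
  "bergman_measure \<alpha> i = density (slice_lebesgue i)
     (\<lambda>z. ennreal ((\<alpha> + 1) / pi * (1 - (norm z)\<^sup>2) powr \<alpha>) * indicator (slice_disc i) z)"

definition bergman_space :: "real \<Rightarrow> quat \<Rightarrow> (quat \<Rightarrow> quat) set" where
  "bergman_space \<alpha> i =
     {f \<in> slice_regular_space. integrable (bergman_measure \<alpha> i) (\<lambda>z. (norm (f z))\<^sup>2)}"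

definition bergman_inner :: "real \<Rightarrow> quat \<Rightarrow> (quat \<Rightarrow> quat) \<Rightarrow> (quat \<Rightarrow> quat) \<Rightarrow> quat" where
  "bergman_inner \<alpha> i f g = (LINT z|bergman_measure \<alpha> i. qcnj (f z) * g z)"

definition bergman_norm :: "real \<Rightarrow> quat \<Rightarrow> (quat \<Rightarrow> quat) \<Rightarrow> real" where
  "bergman_norm \<alpha> i f = sqrt (qRe (bergman_inner \<alpha> i f f))"

definition bergman_kernel :: "real \<Rightarrow> quat \<Rightarrow> quat \<Rightarrow> quat \<Rightarrow> quat" where
  "bergman_kernel \<alpha> i w = (THE K. K \<in> bergman_space \<alpha> i \<and>
     (\<forall>f\<in>bergman_space \<alpha> i. f w = bergman_inner \<alpha> i K f))"

definition normalized_kernel :: "real \<Rightarrow> quat \<Rightarrow> quat \<Rightarrow> quat \<Rightarrow> quat" where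
  "normalized_kernel \<alpha> i w =
     (\<lambda>x. bergman_kernel \<alpha> i w x /\<^sub>R bergman_norm \<alpha> i (bergman_kernel \<alpha> i w))"

section \<open>Operators\<close>

definition slice_J :: "quat \<Rightarrow> (quat \<Rightarrow> quat) \<Rightarrow> quat \<Rightarrow> quat" where
  "slice_J i f = slice_ext i (\<lambda>z. i * f z)"

text \<open>
  Operators are HOL functions of which only the values on the Bergman space matter.
\<close>

definition bounded_right_linear ::
    "real \<Rightarrow> quat \<Rightarrow> ((quat \<Rightarrow> quat) \<Rightarrow> quat \<Rightarrow> quat) \<Rightarrow> bool" where
  "bounded_right_linear \<alpha> i T \<longleftrightarrow>
     (\<forall>f\<in>bergman_space \<alpha> i. T f \<in> bergman_space \<alpha> i) \<and>
     (\<forall>f\<in>bergman_space \<alpha> i. \<forall>g\<in>bergman_space \<alpha> i.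
        T (\<lambda>x. f x + g x) = (\<lambda>x. T f x + T g x)) \<and>
     (\<forall>f\<in>bergman_space \<alpha> i. \<forall>c. T (\<lambda>x. f x * c) = (\<lambda>x. T f x * c)) \<and>
     (\<exists>B. \<forall>f\<in>bergman_space \<alpha> i. bergman_norm \<alpha> i (T f) \<le> B * bergman_norm \<alpha> i f)"

definition operators_commuting_J ::
    "real \<Rightarrow> quat \<Rightarrow> ((quat \<Rightarrow> quat) \<Rightarrow> quat \<Rightarrow> quat) set" where
  "operators_commuting_J \<alpha> i = {T. bounded_right_linear \<alpha> i T \<and>
     (\<forall>f\<in>bergman_space \<alpha> i. T (slice_J i f) = slice_J i (T f))}"

definition operator_norm ::
    "real \<Rightarrow> quat \<Rightarrow> ((quat \<Rightarrow> quat) \<Rightarrow> quat \<Rightarrow> quat) \<Rightarrow> real" where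
  "operator_norm \<alpha> i T =
     (SUP f\<in>{f \<in> bergman_space \<alpha> i. bergman_norm \<alpha> i f \<le> 1}. bergman_norm \<alpha> i (T f))"

definition berezin ::
    "real \<Rightarrow> quat \<Rightarrow> ((quat \<Rightarrow> quat) \<Rightarrow> quat \<Rightarrow> quat) \<Rightarrow> quat \<Rightarrow> quat" where
  "berezin \<alpha> i T z =
     bergman_inner \<alpha> i (normalized_kernel \<alpha> i z) (T (normalized_kernel \<alpha> i z))"

section \<open>The Bergman metric\<close>

definition pseudohyperbolic :: "quat \<Rightarrow> quat \<Rightarrow> real" where
  "pseudohyperbolic z w = norm (z - w) / norm (1 - z * qcnj w)"

definition bergman_metric :: "quat \<Rightarrow> quat \<Rightarrow> real" where
  "bergman_metric z w = 1 / 2 * ln ((1 + pseudohyperbolic z w) / (1 - pseudohyperbolic z w))"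

end

theory Submission
  imports Defs "HOL-Complex_Analysis.Complex_Analysis"
begin

text \<open>
  Since \<open>J K\<^sub>z = K\<^sub>z i\<close>, an operator commuting with \<open>J\<close> has a Berezin transform commuting with \<open>i\<close>.
  It is therefore unchanged when \<open>k\<^sub>w\<close> is multiplied by a unit of the slice, so \<open>\<langle>k\<^sub>z, k\<^sub>w\<rangle>\<close> may be
  assumed real, and polarisation gives \<open>2 \<parallel>T\<parallel> sqrt (1 - \<bar>\<langle>k\<^sub>z, k\<^sub>w\<rangle>\<bar>\<^sup>2)\<close> as a bound for the difference
  of the Berezin transforms.
  Here \<open>\<bar>\<langle>k\<^sub>z, k\<^sub>w\<rangle>\<bar>\<^sup>2 = (1 - \<rho>\<^sup>2) powr (2 + \<alpha>)\<close>, and the estimate follows from Bernoulli's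
  inequality and \<open>\<rho> \<le> \<beta>\<close>.  For sharpness, \<open>T\<close> exchanges the unit vectors \<open>1\<close> and
  \<open>sqrt (2 + \<alpha>) z\<close> and kills their orthogonal complement; one takes \<open>w = 0\<close> and lets a real \<open>z\<close>
  tend to \<open>0\<close>.  The formula for the kernel comes from the moments of the measure, the vanishing of the
  integral of \<open>z\<^sup>m cnj z\<^sup>n\<close> for \<open>m \<noteq> n\<close>, and the binomial series.
\<close>

section \<open>The weighted measure on the complex disc\<close>

text \<open>The obstacle is that scalars act on the right and do not commute: replacing k_w by k_w u
  turns the form <k_w, T k_w> into conj(u) <k_w, T k_w> u, in general a different quaternion.
  Commutation with i removes the effect exactly for u in the slice, which is enough because <k_z,
  k_w> lies in the slice. The relation J K_z = K_z i holds because K_z takes slice values on the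
  slice, where left and right multiplication by i agree. The functions live on the quaternionic ball
  while the integrals see only the slice. The representation formula makes restriction to the slice
  a faithful model of the space, and quaternionic integrals become complex ones through a projection
  that is left linear over the slice. The constant sqrt (2 + \<alpha>) arises twice: from the
  exponent 2 + \<alpha> of the kernel in the upper bound, and in sharpness as 1 / norm of z, since
  |z|^2 has integral 1 / (2 + \<alpha>). To first order in a small real r, the normalised kernel is
  1 plus r sqrt (2 + \<alpha>) times the second unit vector, so the form of the exchange operator is
  2 sqrt (2 + \<alpha>) r.\<close>

lemma ball_borel [measurable]: "ball c r \<in> sets borel"
  by simp

section \<open>Invariance of Lebesgue measure under translations and linear isometries\<close>

lemma nn_integral_lborel_translate:
  fixes f :: "'a::euclidean_space \<Rightarrow> ennreal"
  assumes [measurable]: "f \<in> borel_measurable borel"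
  shows "(\<integral>\<^sup>+x. f (c + x) \<partial>lborel) = (\<integral>\<^sup>+x. f x \<partial>lborel)"
proof -
  have "(\<integral>\<^sup>+x. f x \<partial>lborel) = (\<integral>\<^sup>+x. f x \<partial>distr lborel borel ((+) c))"
    by (simp add: lborel_distr_plus)
  also have "\<dots> = (\<integral>\<^sup>+x. f (c + x) \<partial>lborel)"
    by (subst nn_integral_distr) auto
  finally show ?thesis by simp
qed

text \<open>Integrate \<open>indicator (ball 0 1) y * g (L x)\<close> over both variables, and shift first \<open>x\<close>
  and then \<open>y\<close>: this moves \<open>L\<close> from \<open>g\<close> to the indicator, which is invariant under it.\<close>

lemma nn_integral_lborel_isometry:
  fixes L :: "'a::euclidean_space \<Rightarrow> 'a"
  assumes L: "linear L" and nL: "\<And>x. norm (L x) = norm x"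
    and g [measurable]: "g \<in> borel_measurable borel"
  shows "(\<integral>\<^sup>+x. g (L x) \<partial>lborel) = (\<integral>\<^sup>+x. g x \<partial>lborel)"
proof -
  let ?B = "ball (0::'a) 1"
  let ?b = "emeasure lborel ?B"
  have [measurable]: "L \<in> borel_measurable borel"
    using L by (intro borel_measurable_continuous_onI linear_continuous_on linear_linear[THEN iffD2])
  have "inj L"
    using L nL by (metis linear_injective_0 norm_eq_zero)
  then have "surj L"
    using L linear_injective_imp_surjective by blast
  then obtain M where M: "\<And>y. L (M y) = y"
    by (metis surjD)
  have diff: "y - L x = L (M y - x)" for x y
    by (simp add: linear_diff[OF L] M)
  have "?b * (\<integral>\<^sup>+x. g (L x) \<partial>lborel) = (\<integral>\<^sup>+y. indicator ?B y * (\<integral>\<^sup>+x. g (L x) \<partial>lborel) \<partial>lborel)"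
    by (subst nn_integral_multc) auto
  also have "\<dots> = (\<integral>\<^sup>+y. indicator ?B y * (\<integral>\<^sup>+x. g (L (M y + x)) \<partial>lborel) \<partial>lborel)"
    by (simp add: nn_integral_lborel_translate[where f="\<lambda>x. g (L x)"])
  also have "\<dots> = (\<integral>\<^sup>+y. (\<integral>\<^sup>+x. indicator ?B y * g (y + L x) \<partial>lborel) \<partial>lborel)"
    by (simp add: linear_add[OF L] M nn_integral_cmult)
  also have "\<dots> = (\<integral>\<^sup>+x. (\<integral>\<^sup>+y. indicator ?B y * g (y + L x) \<partial>lborel) \<partial>lborel)"
    by (rule lborel_pair.Fubini') measurable
  also have "\<dots> = (\<integral>\<^sup>+x. (\<integral>\<^sup>+y. indicator ?B (- L x + y) * g y \<partial>lborel) \<partial>lborel)"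
  proof (rule nn_integral_cong)
    fix x
    show "(\<integral>\<^sup>+y. indicator ?B y * g (y + L x) \<partial>lborel) = (\<integral>\<^sup>+y. indicator ?B (- L x + y) * g y \<partial>lborel)"
      using nn_integral_lborel_translate[of "\<lambda>y. indicator ?B y * g (y + L x)" "- L x"] by (simp add: add.commute del: ball_borel)
  qed
  also have "\<dots> = (\<integral>\<^sup>+y. (\<integral>\<^sup>+x. indicator ?B (- L x + y) * g y \<partial>lborel) \<partial>lborel)"
    by (rule lborel_pair.Fubini') measurable
  also have "\<dots> = (\<integral>\<^sup>+y. (\<integral>\<^sup>+x. indicator (ball (M y) 1) x * g y \<partial>lborel) \<partial>lborel)"
  proof (intro nn_integral_cong)
    fix x y
    have "norm (- L x + y) = dist (M y) x"
      using diff[of y x] nL by (simp add: dist_norm)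
    then show "indicator ?B (- L x + y) * g y = indicator (ball (M y) 1) x * g y"
      by (simp add: indicator_def)
  qed
  also have "\<dots> = (\<integral>\<^sup>+y. ?b * g y \<partial>lborel)"
    by (subst nn_integral_multc) (auto simp: emeasure_ball)
  also have "\<dots> = ?b * (\<integral>\<^sup>+y. g y \<partial>lborel)"
    by (simp add: nn_integral_cmult)
  \<comment> \<open>The volume of the unit ball is neither 0 nor infinite, so it cancels.\<close>
  finally show ?thesis
    using unit_ball_vol_pos[of "real DIM('a)"] by (simp add: ennreal_mult_cancel_left emeasure_ball del: unit_ball_vol_pos)
qed

text \<open>Complex model of \<open>bergman_measure\<close>, which is its image under the slice
  embedding (\<open>bergman_measure_eq_distr\<close>). Integrals over the slice are computed here,
  where complex analysis applies.\<close>

definition disc_measure :: "real \<Rightarrow> complex measure" where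
  "disc_measure \<alpha> = density lborel
     (\<lambda>z. ennreal ((\<alpha> + 1) / pi * (1 - (norm z)\<^sup>2) powr \<alpha>) * indicator (ball 0 1) z)"

lemma sets_disc_measure [measurable_cong, simp]: "sets (disc_measure \<alpha>) = sets borel"
  by (simp add: disc_measure_def)

lemma space_disc_measure [simp]: "space (disc_measure \<alpha>) = UNIV"
  by (simp add: disc_measure_def)

lemma nn_integral_disc_measure:
  assumes [measurable]: "f \<in> borel_measurable borel"
  shows "(\<integral>\<^sup>+z. f z \<partial>disc_measure \<alpha>) = (\<integral>\<^sup>+z. ennreal ((\<alpha> + 1) / pi * (1 - (norm z)\<^sup>2) powr \<alpha>)
     * indicator (ball 0 1) z * f z \<partial>lborel)"
  unfolding disc_measure_def by (subst nn_integral_density) auto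

lemma AE_disc_measure: "AE z in disc_measure \<alpha>. norm z < 1"
proof -
  have *: "(\<lambda>z::complex. ennreal ((\<alpha> + 1) / pi * (1 - (norm z)\<^sup>2) powr \<alpha>) * indicator (ball 0 1) z)
     \<in> borel_measurable lborel"
    by measurable
  show ?thesis
    unfolding disc_measure_def AE_density[OF *] by (auto simp: indicator_def split: if_splits)
qed

lemma nn_integral_disc_measure_rotate:
  assumes u: "norm u = 1" and [measurable]: "f \<in> borel_measurable borel"
  shows "(\<integral>\<^sup>+z. f (u * z) \<partial>disc_measure \<alpha>) = (\<integral>\<^sup>+z. f z \<partial>disc_measure \<alpha>)"
proof -
  have "linear ((*) u)"
    by (simp add: bounded_linear.linear bounded_linear_mult_right)
  note * = nn_integral_lborel_isometry[OF this, of "\<lambda>z. ennreal ((\<alpha> + 1) / pi * (1 - (norm z)\<^sup>2) powr \<alpha>)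
     * indicator (ball 0 1) z * f z"]
  show ?thesis
    using * u by (subst (1 2) nn_integral_disc_measure) (auto simp: norm_mult indicator_def)
qed

lemma distr_disc_measure_rotate:
  assumes u: "norm u = 1"
  shows "distr (disc_measure \<alpha>) borel ((*) u) = disc_measure \<alpha>"
proof (rule measure_eqI)
  fix A assume "A \<in> sets (distr (disc_measure \<alpha>) borel ((*) u))"
  then have A [measurable]: "A \<in> sets borel" by simp
  have "emeasure (distr (disc_measure \<alpha>) borel ((*) u)) A
      = (\<integral>\<^sup>+z. indicator A z \<partial>distr (disc_measure \<alpha>) borel ((*) u))"
    by (subst nn_integral_indicator) auto
  also have "\<dots> = (\<integral>\<^sup>+z. indicator A (u * z) \<partial>disc_measure \<alpha>)"
    by (subst nn_integral_distr) auto
  also have "\<dots> = (\<integral>\<^sup>+z. indicator A z \<partial>disc_measure \<alpha>)"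
    by (rule nn_integral_disc_measure_rotate[OF u]) auto
  finally show "emeasure (distr (disc_measure \<alpha>) borel ((*) u)) A = emeasure (disc_measure \<alpha>) A"
    by simp
qed simp

text \<open>This takes the place of polar coordinates. For 0 \<le> x < 1 the part of the unit disc
  with |z|^2 > x has area pi (1 - x), which is affine in x, so the image measure is a multiple of
  Lebesgue measure on the unit interval. Finite values on the half-lines \<open>{x<..}\<close>
  determine a measure on the line.\<close>

lemma distr_norm_square_disc:
  "distr (density lborel (indicator (ball (0::complex) 1))) borel (\<lambda>z. (norm z)\<^sup>2)
     = density lborel (\<lambda>t. ennreal pi * indicator {0<..<1} t)" (is "?M = ?N")
proof (rule measure_eqI_lessThan)
  fix x :: real
  let ?S = "{z::complex. x < (norm z)\<^sup>2}"
  have S [measurable]: "?S \<in> sets borel"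
    by measurable
  have "emeasure ?M {x<..} = emeasure (density lborel (indicator (ball (0::complex) 1))) ?S"
    by (subst emeasure_distr) (simp_all add: vimage_def)
  also have "\<dots> = (\<integral>\<^sup>+z. indicator (ball 0 1 \<inter> ?S) z \<partial>lborel)"
    by (subst emeasure_density) (auto simp: indicator_def simp del: nn_integral_indicator intro!: nn_integral_cong)
  also have "\<dots> = emeasure lborel (ball 0 1 \<inter> ?S)"
    by (rule nn_integral_indicator) simp
  finally have M: "emeasure ?M {x<..} = emeasure lborel (ball 0 1 \<inter> ?S)" .
  have "emeasure ?N {x<..} = (\<integral>\<^sup>+t. ennreal pi * indicator ({0<..<1} \<inter> {x<..}) t \<partial>lborel)"
    by (subst emeasure_density) (auto simp: indicator_def intro!: nn_integral_cong)
  also have "\<dots> = ennreal pi * emeasure lborel ({0<..<1} \<inter> {x<..})"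
    by (subst nn_integral_cmult) simp_all
  finally have N: "emeasure ?N {x<..} = ennreal pi * emeasure lborel ({0<..<1} \<inter> {x<..})" .
  have ball: "emeasure lborel (ball (0::complex) 1) = ennreal pi"
    by (simp add: emeasure_ball unit_ball_vol_2)
  have "emeasure ?M {x<..} \<le> emeasure lborel (ball (0::complex) 1)"
    unfolding M by (intro emeasure_mono) auto
  then show "emeasure ?M {x<..} < \<infinity>"
    using ball by (simp add: order_le_less_trans)
  consider "x < 0" | "0 \<le> x" "x < 1" | "x \<ge> 1" by linarith
  then show "emeasure ?M {x<..} = emeasure ?N {x<..}"
  proof cases
    case 1
    then have "ball (0::complex) 1 \<inter> {z. x < (norm z)\<^sup>2} = ball 0 1"
      by (auto intro: less_le_trans[OF _ zero_le_power2])
    moreover have "{0<..<1} \<inter> {x<..} = {0<..<1}" using 1 by auto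
    ultimately show ?thesis by (simp add: M N ball)
  next
    case 2
    have eq: "x < (norm z)\<^sup>2 \<longleftrightarrow> \<not> norm z \<le> sqrt x" for z :: complex
      using 2 real_sqrt_le_iff[of "(norm z)\<^sup>2" x] by (simp add: not_le)
    have "ball (0::complex) 1 \<inter> {z. x < (norm z)\<^sup>2} = ball 0 1 - cball 0 (sqrt x)"
      by (rule set_eqI) (simp only: eq Int_iff Diff_iff mem_Collect_eq mem_cball_0)
    moreover have "emeasure lborel (ball (0::complex) 1 - cball 0 (sqrt x)) = ennreal pi - ennreal (pi * x)"
    proof (subst emeasure_Diff)
      show "cball 0 (sqrt x) \<subseteq> ball (0::complex) 1"
        using 2 by (auto simp: subset_eq intro: le_less_trans)
    qed (use 2 in \<open>simp_all add: emeasure_cball emeasure_ball unit_ball_vol_2\<close>)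
    moreover have "{0<..<1} \<inter> {x<..} = {x<..<1}" using 2 by auto
    ultimately show ?thesis
      using 2 by (simp add: M N ennreal_minus right_diff_distrib flip: ennreal_mult')
  next
    case 3
    have "(norm z)\<^sup>2 < 1" if "norm z < 1" for z :: complex
      using that by (simp add: abs_square_less_1)
    then have "ball (0::complex) 1 \<inter> {z. x < (norm z)\<^sup>2} = {}" "{0<..<1} \<inter> {x<..} = {}" 
      using 3 by force+
    then show ?thesis by (simp add: M N)
  qed
qed simp_all

lemma nn_integral_disc_measure_radial:
  assumes [measurable]: "f \<in> borel_measurable borel"
  shows "(\<integral>\<^sup>+z. f ((norm z)\<^sup>2) \<partial>disc_measure \<alpha>)
    = (\<integral>\<^sup>+t. ennreal ((\<alpha> + 1) * (1 - t) powr \<alpha>) * indicator {0<..<1} t * f t \<partial>lborel)"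
proof -
  let ?h = "\<lambda>t. ennreal ((\<alpha> + 1) / pi * (1 - t) powr \<alpha>) * f t"
  have "(\<integral>\<^sup>+z. f ((norm z)\<^sup>2) \<partial>disc_measure \<alpha>)
      = (\<integral>\<^sup>+z. ?h ((norm z)\<^sup>2) \<partial>density lborel (indicator (ball (0::complex) 1)))"
    by (subst nn_integral_disc_measure, simp, subst nn_integral_density) (auto simp: mult_ac)
  also have "\<dots> = (\<integral>\<^sup>+t. ?h t \<partial>distr (density lborel (indicator (ball (0::complex) 1))) borel (\<lambda>z. (norm z)\<^sup>2))"
    by (subst nn_integral_distr) auto
  also have "\<dots> = (\<integral>\<^sup>+x. ennreal pi * indicator {0<..<1} x * ?h x \<partial>lborel)"
    unfolding distr_norm_square_disc by (subst nn_integral_density) auto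
  also have "(\<lambda>x. ennreal pi * indicator {0<..<1} x * ?h x)
      = (\<lambda>x. ennreal ((\<alpha> + 1) * (1 - x) powr \<alpha>) * indicator {0<..<1} x * f x)"
  proof
    fix t
    have "ennreal pi * ennreal ((\<alpha> + 1) / pi * (1 - t) powr \<alpha>) = ennreal ((\<alpha> + 1) * (1 - t) powr \<alpha>)"
      by (subst ennreal_mult'[symmetric]) simp_all
    then show "ennreal pi * indicator {0<..<1} t * ?h t
        = ennreal ((\<alpha> + 1) * (1 - t) powr \<alpha>) * indicator {0<..<1} t * f t"
      by (metis mult.assoc mult.commute)
  qed
  finally show ?thesis .
qed

text \<open>With t = |z|^2 the moment is (\<alpha> + 1) Beta(n + 1, \<alpha> + 1), and the
  functional equation of Gamma turns this into a Pochhammer quotient, the form in which binomial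
  coefficients will cancel it.\<close>

lemma disc_moment_nn:
  assumes "\<alpha> > -1"
  shows "(\<integral>\<^sup>+z. ennreal (((norm z)\<^sup>2) ^ n) \<partial>disc_measure \<alpha>) = ennreal (fact n / pochhammer (\<alpha> + 2) n)"
proof -
  have "((\<lambda>t. t powr (real n + 1 - 1) * (1 - t) powr (\<alpha> + 1 - 1)) has_integral Beta (real n + 1) (\<alpha> + 1)) {0..1}"
    using assms by (intro has_integral_Beta_real) auto
  then have "((\<lambda>t. (\<alpha> + 1) * (t powr real n * (1 - t) powr \<alpha>)) has_integral (\<alpha> + 1) * Beta (real n + 1) (\<alpha> + 1)) {0<..<1}"
    by (intro has_integral_mult_right) (simp add: has_integral_Icc_iff_Ioo)
  then have "(\<integral>\<^sup>+t\<in>{0<..<1}. ennreal ((\<alpha> + 1) * (t powr real n * (1 - t) powr \<alpha>)) \<partial>lborel)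
      = ennreal ((\<alpha> + 1) * Beta (real n + 1) (\<alpha> + 1))"
    using assms by (intro nn_integral_has_integral_lebesgue'[THEN trans]) (auto simp: nn_integral_completion)
  also have "(\<alpha> + 1) * Beta (real n + 1) (\<alpha> + 1) = fact n / pochhammer (\<alpha> + 2) n"
  proof -
    have np: "x \<notin> \<int>\<^sub>\<le>\<^sub>0" if "x > 0" for x :: real
      using that nonpos_Ints_nonpos by force
    have "Gamma (\<alpha> + 2) = (\<alpha> + 1) * Gamma (\<alpha> + 1)"
      using Gamma_plus1[of "\<alpha> + 1"] np[of "\<alpha> + 1"] assms by (simp add: add.commute add.left_commute)
    moreover have "pochhammer (\<alpha> + 2) n = Gamma (\<alpha> + 2 + real n) / Gamma (\<alpha> + 2)"
      using np[of "\<alpha> + 2"] assms by (intro pochhammer_Gamma) auto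
    moreover have "Gamma (real n + 1) = fact n"
      using Gamma_fact[of n, where 'a=real] by (simp add: add.commute)
    moreover have "Gamma (\<alpha> + 1) > 0" "Gamma (\<alpha> + 2 + real n) > 0"
      using assms by (auto intro!: Gamma_real_pos)
    moreover have "real n + 1 + (\<alpha> + 1) = \<alpha> + 2 + real n" by simp
    ultimately show ?thesis using assms by (simp add: Beta_def ac_simps)
  qed
  finally have *: "(\<integral>\<^sup>+t\<in>{0<..<1}. ennreal ((\<alpha> + 1) * (t powr real n * (1 - t) powr \<alpha>)) \<partial>lborel)
      = ennreal (fact n / pochhammer (\<alpha> + 2) n)" .
  show ?thesis
    unfolding *[symmetric]
  proof (subst nn_integral_disc_measure_radial, simp, intro nn_integral_cong)
    fix t :: real
    show "ennreal ((\<alpha> + 1) * (1 - t) powr \<alpha>) * indicator {0<..<1} t * ennreal (t ^ n) =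
         ennreal ((\<alpha> + 1) * (t powr real n * (1 - t) powr \<alpha>)) * indicator {0<..<1} t"
      using assms by (auto simp: indicator_def powr_realpow mult_ac simp flip: ennreal_mult')
  qed
qed

lemma finite_measure_disc_measure:
  assumes "\<alpha> > -1"
  shows "finite_measure (disc_measure \<alpha>)"
  using disc_moment_nn[OF assms, of 0] by (intro finite_measureI) simp

lemma disc_moment:
  assumes "\<alpha> > -1"
  shows "(LINT z|disc_measure \<alpha>. ((norm z)\<^sup>2) ^ n) = fact n / pochhammer (\<alpha> + 2) n"
proof -
  have "0 \<le> fact n / pochhammer (\<alpha> + 2) n"
    using assms by (intro divide_nonneg_nonneg pochhammer_nonneg) auto
  then show ?thesis
    by (subst integral_eq_nn_integral) (simp_all add: disc_moment_nn[OF assms])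
qed

section \<open>The reproducing formula on the complex disc\<close>

lemma cnj_borel_measurable [measurable]: "cnj \<in> borel_measurable borel"
  by (intro borel_measurable_continuous_onI continuous_intros)

lemma powr_complex_borel_measurable [measurable]: "(\<lambda>z::complex. z powr b) \<in> borel_measurable borel"
  unfolding powr_def by measurable

text \<open>Cauchy's formula for the n-th derivative of u \<mapsto> F(u z) over the unit circle,
  where cnj u = 1 / u. The derivative contributes the factor z^n and the conjugate power the factor
  (cnj z)^n; together they give |z|^(2n).\<close>

lemma circle_mean_mult_cnj_power:
  assumes F: "F holomorphic_on ball 0 1" and z: "norm z < 1"
  shows "((\<lambda>t. F (exp (2 * of_real pi * \<i> * of_real t) * z) * cnj (exp (2 * of_real pi * \<i> * of_real t) * z) ^ n)
    has_integral ((deriv ^^ n) F 0 / fact n * of_real (((norm z)\<^sup>2) ^ n))) {0..1}"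
proof -
  let ?e = "\<lambda>t::real. exp (2 * of_real pi * \<i> * of_real t)"
  define G where "G u = F (u * z)" for u
  \<comment> \<open>Some room beyond radius 1 makes \<open>G\<close> holomorphic on a neighbourhood
    of the closed unit disc, as Cauchy's formula on the unit circle requires.\<close>
  obtain r where r: "r > 1" "r * norm z < 1"
  proof (cases "z = 0")
    case True
    then show ?thesis by (intro that[of 2]) auto
  next
    case False
    have "1 < 1 / norm z" using False z by (simp add: field_simps)
    then obtain r where "1 < r" "r < 1 / norm z" using dense by blast
    then show ?thesis using False by (intro that[of r]) (auto simp: field_simps)
  qed
  have sub: "u * z \<in> ball 0 1" if "u \<in> ball 0 r" for u
  proof -
    have "norm u * norm z \<le> r * norm z" using that by (intro mult_right_mono) auto
    then show ?thesis using r by (simp add: norm_mult)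
  qed
  have G: "G holomorphic_on ball 0 r"
    unfolding G_def using sub
    by (intro holomorphic_on_compose_gen[OF _ F, unfolded o_def]) (auto intro!: holomorphic_intros)
  have contour: "((\<lambda>u. G u / (u - 0) ^ (Suc n)) has_contour_integral ((2 * pi * \<i>) / (fact n) * (deriv ^^ n) G 0)) (circlepath 0 1)"
  proof (rule Cauchy_has_contour_integral_higher_derivative_circlepath)
    show "continuous_on (cball 0 1) G" "G holomorphic_on ball 0 1"
      using r by (auto intro!: holomorphic_on_imp_continuous_on holomorphic_on_subset[OF G])
  qed simp
  have deriv_G: "(deriv ^^ n) G 0 = z ^ n * (deriv ^^ n) F 0"
  proof -
    have "(deriv ^^ n) (\<lambda>u. F (z * u)) 0 = z ^ n * (deriv ^^ n) F (z * 0)"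
      using sub r by (intro higher_deriv_compose_linear[OF F, of "ball 0 r"]) (auto simp: mult.commute)
    then show ?thesis by (simp add: G_def[abs_def] mult.commute)
  qed
  have "((\<lambda>t. G (?e t) / ?e t ^ Suc n * (2 * pi * \<i> * ?e t)) has_integral
      (2 * pi * \<i>) / (fact n) * (z ^ n * (deriv ^^ n) F 0)) {0..1}"
  proof -
    have "circlepath 0 1 t = ?e t" "0 \<le> t \<Longrightarrow> t \<le> 1 \<Longrightarrow>
        vector_derivative (circlepath 0 1) (at t within {0..1}) = 2 * pi * \<i> * ?e t" for t
      by (simp add: circlepath) (simp add: vector_derivative_circlepath01)
    then show ?thesis
      using contour unfolding has_contour_integral_def deriv_G
      by (subst (asm) has_integral_cong[where g = "\<lambda>t. G (?e t) / ?e t ^ Suc n * (2 * pi * \<i> * ?e t)"])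
        auto
  qed
  then have "((\<lambda>t. cnj z ^ n / (2 * pi * \<i>) * (G (?e t) / ?e t ^ Suc n * (2 * pi * \<i> * ?e t))) has_integral
      cnj z ^ n / (2 * pi * \<i>) * ((2 * pi * \<i>) / (fact n) * (z ^ n * (deriv ^^ n) F 0))) {0..1}"
    by (rule has_integral_mult_right)
  moreover have "cnj z ^ n / (2 * pi * \<i>) * ((2 * pi * \<i>) / (fact n) * (z ^ n * (deriv ^^ n) F 0))
      = (deriv ^^ n) F 0 / fact n * of_real (((norm z)\<^sup>2) ^ n)"
  proof -
    have "complex_of_real (((norm z)\<^sup>2) ^ n) = z ^ n * cnj z ^ n"
      by (metis complex_norm_square of_real_power power_mult_distrib)
    then show ?thesis by (simp add: mult_ac del: of_real_power)
  qed
  moreover have "cnj z ^ n / (2 * pi * \<i>) * (G (?e t) / ?e t ^ Suc n * (2 * pi * \<i> * ?e t))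
      = F (?e t * z) * cnj (?e t * z) ^ n" for t
  proof -
    have "cnj (?e t) = inverse (?e t)"
      by (simp add: exp_cnj exp_minus[symmetric])
    then have eq: "cnj (?e t * z) ^ n = cnj z ^ n / ?e t ^ n"
      by (simp add: power_mult_distrib divide_inverse power_inverse mult.commute)
    have "a / c * (g / e ^ Suc n * (c * e)) = g * (a / e ^ n)" if "c \<noteq> 0" "e \<noteq> 0" for a c g e :: complex
      using that by (simp add: field_simps)
    then show ?thesis unfolding G_def eq by (rule) simp_all
  qed
  ultimately show ?thesis by simp
qed

section \<open>Averaging over rotations and integrals against powers of the conjugate\<close>

lemma
  fixes H :: "complex \<Rightarrow> 'a::{banach, second_countable_topology}"
  assumes "norm u = 1" and "integrable (disc_measure \<alpha>) H"
  shows integrable_disc_measure_rotate: "integrable (disc_measure \<alpha>) (\<lambda>z. H (u * z))"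
    and integral_disc_measure_rotate: "(LINT z|disc_measure \<alpha>. H (u * z)) = (LINT z|disc_measure \<alpha>. H z)"
proof -
  have H: "integrable (distr (disc_measure \<alpha>) borel ((*) u)) H"
    using assms by (simp add: distr_disc_measure_rotate)
  then have [measurable]: "H \<in> borel_measurable borel" by auto
  show "integrable (disc_measure \<alpha>) (\<lambda>z. H (u * z))"
    using H by (subst (asm) integrable_distr_eq) auto
  have "(LINT z|distr (disc_measure \<alpha>) borel ((*) u). H z) = (LINT z|disc_measure \<alpha>. H (u * z))"
    by (subst integral_distr) auto
  then show "(LINT z|disc_measure \<alpha>. H (u * z)) = (LINT z|disc_measure \<alpha>. H z)"
    using assms by (simp add: distr_disc_measure_rotate)
qed

text \<open>Every rotation preserves the integral, so averaging over the angle and exchanging the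
  two integrals changes nothing. Fubini applies because all rotated functions have the same L1
  norm.\<close>

lemma integral_disc_measure_circle_mean:
  fixes H :: "complex \<Rightarrow> complex"
  assumes \<alpha>: "\<alpha> > -1" and H: "integrable (disc_measure \<alpha>) H"
  shows "(LINT z|disc_measure \<alpha>. H z) =
    (LINT z|disc_measure \<alpha>. (LINT t:{0..1}|lborel. H (exp (2 * of_real pi * \<i> * of_real t) * z)))"
proof -
  let ?e = "\<lambda>t::real. exp (2 * of_real pi * \<i> * of_real t)"
  let ?M = "disc_measure \<alpha>"
  interpret M: finite_measure ?M using \<alpha> by (rule finite_measure_disc_measure)
  interpret P: pair_sigma_finite lborel ?M ..
  have [measurable]: "H \<in> borel_measurable borel" using H by auto
  have [measurable]: "?e \<in> borel_measurable borel"
    by (intro borel_measurable_continuous_onI continuous_intros)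
  have ne: "norm (?e t) = 1" for t by simp
  have rot: "integrable ?M (\<lambda>z. H (?e t * z))" "(LINT z|?M. H (?e t * z)) = (LINT z|?M. H z)"
    "(LINT z|?M. norm (H (?e t * z))) = (LINT z|?M. norm (H z))" for t
    using integrable_disc_measure_rotate[OF ne H] integral_disc_measure_rotate[OF ne H]
      integral_disc_measure_rotate[OF ne integrable_norm[OF H]] by auto
  let ?f = "\<lambda>t z. indicator {0..1::real} t *\<^sub>R H (?e t * z)"
  have int: "integrable (lborel \<Otimes>\<^sub>M ?M) (\<lambda>(t, z). ?f t z)"
  proof (rule P.Fubini_integrable)
    show "(\<lambda>(t, z). ?f t z) \<in> borel_measurable (lborel \<Otimes>\<^sub>M ?M)"
      by measurable
    show "integrable lborel (\<lambda>t. LINT z|?M. norm (case (t, z) of (t, z) \<Rightarrow> ?f t z))"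
      by (simp add: rot)
    show "AE t in lborel. integrable ?M (\<lambda>z. case (t, z) of (t, z) \<Rightarrow> ?f t z)"
      by (simp add: rot)
  qed
  have "(LINT z|?M. (LINT t|lborel. ?f t z)) = (LINT t|lborel. (LINT z|?M. ?f t z))"
    using P.Fubini_integral[OF int] .
  also have "\<dots> = (LINT z|?M. H z)"
    by (simp add: rot)
  finally show ?thesis by (simp add: set_lebesgue_integral_def)
qed

text \<open>\<open>F\<close> is only known to be integrable, so its power series is not integrated
  term by term. The circle mean isolates the n-th Taylor coefficient, and what remains to be
  integrated is |z|^(2n).\<close>

lemma integral_disc_measure_mult_cnj_power:
  assumes \<alpha>: "\<alpha> > -1" and F: "F holomorphic_on ball 0 1" and int: "integrable (disc_measure \<alpha>) F"
  shows "(LINT z|disc_measure \<alpha>. F z * cnj z ^ n)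
    = (deriv ^^ n) F 0 / fact n * of_real (fact n / pochhammer (\<alpha> + 2) n)"
    and "integrable (disc_measure \<alpha>) (\<lambda>z. F z * cnj z ^ n)"
proof -
  let ?e = "\<lambda>t::real. exp (2 * of_real pi * \<i> * of_real t)"
  let ?M = "disc_measure \<alpha>" and ?a = "(deriv ^^ n) F 0 / fact n"
  have [measurable]: "F \<in> borel_measurable borel" using int by auto
  have [measurable]: "?e \<in> borel_measurable borel"
    by (intro borel_measurable_continuous_onI continuous_intros)
  show int': "integrable ?M (\<lambda>z. F z * cnj z ^ n)"
  proof (rule Bochner_Integration.integrable_bound[OF int])
    show "AE z in ?M. norm (F z * cnj z ^ n) \<le> norm (F z)"
      using AE_disc_measure by eventually_elim (auto simp: norm_mult norm_power intro!: mult_left_le power_le_one)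
  qed simp
  have "(LINT z|?M. F z * cnj z ^ n) = (LINT z|?M. (LINT t:{0..1}|lborel. F (?e t * z) * cnj (?e t * z) ^ n))"
    using integral_disc_measure_circle_mean[OF \<alpha> int'] by simp
  also have "\<dots> = (LINT z|?M. ?a * of_real (((norm z)\<^sup>2) ^ n))"
  proof (rule integral_cong_AE)
    show "AE z in ?M. (LINT t:{0..1}|lborel. F (?e t * z) * cnj (?e t * z) ^ n) = ?a * of_real (((norm z)\<^sup>2) ^ n)"
      using AE_disc_measure
    proof eventually_elim
      case (elim z)
      have "continuous_on {0..1} (\<lambda>t. F (?e t * z))"
        using elim by (intro continuous_on_compose2[OF holomorphic_on_imp_continuous_on[OF F]] continuous_intros)
          (auto simp: norm_mult)
      then have "set_integrable lborel {0..1} (\<lambda>t. F (?e t * z) * cnj (?e t * z) ^ n)"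
        by (intro borel_integrable_atLeastAtMost' continuous_intros)
      then show ?case
        using circle_mean_mult_cnj_power[OF F elim, of n]
        by (simp add: set_borel_integral_eq_integral integral_unique)
    qed
  qed (unfold set_lebesgue_integral_def, measurable)
  also have "\<dots> = ?a * of_real (fact n / pochhammer (\<alpha> + 2) n)"
    using disc_moment[OF \<alpha>, of n] by (simp del: of_real_power of_real_divide)
  finally show "(LINT z|disc_measure \<alpha>. F z * cnj z ^ n) = ?a * of_real (fact n / pochhammer (\<alpha> + 2) n)" .
qed

text \<open>The kernel is expanded instead of \<open>F\<close>: for |w| < 1 its binomial
  coefficients \<open>c n\<close> are absolutely summable, and |c_n| |F| dominates the terms. Since
  (-1)^n (-p gchoose n) is the Pochhammer symbol of p = 2 + \<alpha> over n!, the reciprocal of the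
  n-th moment, \<open>c n\<close> times the moment is w^n, and the Taylor series of \<open>F\<close>
  at w appears.\<close>

lemma disc_reproducing:
  assumes \<alpha>: "\<alpha> > -1" and F: "F holomorphic_on ball 0 1" and int: "integrable (disc_measure \<alpha>) F"
    and w: "norm w < 1"
  shows "(LINT z|disc_measure \<alpha>. cnj ((1 - z * cnj w) powr (- of_real (2 + \<alpha>))) * F z) = F w"
proof -
  let ?M = "disc_measure \<alpha>" and ?p = "complex_of_real (2 + \<alpha>)"
  have [measurable]: "F \<in> borel_measurable borel" using int by auto
  define c where "c n = (- ?p gchoose n) * (- w) ^ n" for n
  \<comment> \<open>At a natural exponent the binomial series is a polynomial and its radius of
    convergence is infinite; excluding this case fixes the radius at 1.\<close>
  have "- ?p \<notin> \<nat>"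
  proof
    assume "- ?p \<in> \<nat>"
    then obtain m where "- ?p = of_nat m" by (auto elim: Nats_cases)
    then have "- (2 + \<alpha>) = real m" by (metis Re_complex_of_real of_real_minus of_real_of_nat_eq)
    then show False using \<alpha> by simp
  qed
  then have "conv_radius (\<lambda>n. - ?p gchoose n) = 1"
    by (simp add: conv_radius_gchoose)
  then have sc: "summable (\<lambda>n. norm (c n))"
    unfolding c_def using w by (intro abs_summable_in_conv_radius) (simp add: one_ereal_def)
  have sums: "(\<lambda>n. c n * cnj z ^ n * F z) sums (cnj ((1 - z * cnj w) powr (- ?p)) * F z)" if z: "norm z < 1" for z
  proof -
    have zw: "norm (- (cnj z * w)) < 1"
      using mult_strict_mono'[of "norm z" 1 "norm w" 1] z w by (simp add: norm_mult)
    \<comment> \<open>This keeps the base off the branch cut, where the principal power need not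
      commute with conjugation.\<close>
    then have "Re (1 - z * cnj w) > 0"
      using complex_Re_le_cmod[of "z * cnj w"] by (simp add: norm_mult)
    then have "cnj ((1 - z * cnj w) powr (- ?p)) = (1 + - (cnj z * w)) powr (- ?p)"
      by (subst cnj_powr) auto
    moreover have "(\<lambda>n. (- ?p gchoose n) * (- (cnj z * w)) ^ n) sums (1 + - (cnj z * w)) powr (- ?p)"
      using zw by (rule gen_binomial_complex)
    moreover have "(- ?p gchoose n) * (- (cnj z * w)) ^ n = c n * cnj z ^ n" for n
    proof -
      have "- (cnj z * w) = - w * cnj z" by simp
      then show ?thesis by (simp only: c_def power_mult_distrib mult.assoc)
    qed
    ultimately show ?thesis by (simp add: sums_mult2)
  qed
  have intn: "integrable ?M (\<lambda>z. c n * cnj z ^ n * F z)" for n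
    using integrable_mult_right[of "c n", OF integral_disc_measure_mult_cnj_power(2)[OF \<alpha> F int, of n]]
    by (simp add: mult_ac)
  have bound: "norm (c n * cnj z ^ n * F z) \<le> norm (c n) * norm (F z)" if "norm z < 1" for n z
    using that by (auto simp: norm_mult norm_power intro!: mult_right_mono mult_left_le power_le_one)
  have "(\<lambda>n. LINT z|?M. c n * cnj z ^ n * F z) sums (LINT z|?M. (\<Sum>n. c n * cnj z ^ n * F z))"
  proof (rule sums_integral[OF intn])
    show "AE z in ?M. summable (\<lambda>n. norm (c n * cnj z ^ n * F z))"
      using AE_disc_measure
    proof eventually_elim
      case (elim z)
      show ?case
        by (rule summable_comparison_test'[OF summable_mult2[OF sc, of "norm (F z)"]])
          (use bound[OF elim] in auto)
    qed
    show "summable (\<lambda>n. LINT z|?M. norm (c n * cnj z ^ n * F z))"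
    proof (rule summable_comparison_test'[OF summable_mult2[OF sc, of "LINT z|?M. norm (F z)"]])
      fix n
      have "(LINT z|?M. norm (c n * cnj z ^ n * F z)) \<le> (LINT z|?M. norm (c n) * norm (F z))"
      proof (rule integral_mono_AE)
        show "AE z in ?M. norm (c n * cnj z ^ n * F z) \<le> norm (c n) * norm (F z)"
          using AE_disc_measure by eventually_elim (rule bound)
      qed (use intn[of n] int in auto)
      then show "norm (LINT z|?M. norm (c n * cnj z ^ n * F z)) \<le> norm (c n) * (LINT z|?M. norm (F z))"
        by simp
    qed
  qed
  moreover have "(LINT z|?M. c n * cnj z ^ n * F z) = (deriv ^^ n) F 0 / fact n * (w - 0) ^ n" for n
  proof -
    have "(LINT z|?M. c n * cnj z ^ n * F z) = c n * (LINT z|?M. F z * cnj z ^ n)"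
      by (simp add: mult_ac flip: integral_mult_right_zero)
    also have "\<dots> = (deriv ^^ n) F 0 / fact n * (c n * of_real (fact n / pochhammer (\<alpha> + 2) n))"
      using integral_disc_measure_mult_cnj_power(1)[OF \<alpha> F int, of n] by (simp add: mult_ac)
    also have "c n * of_real (fact n / pochhammer (\<alpha> + 2) n) = w ^ n"
    proof -
      have "pochhammer (\<alpha> + 2) n > 0" using \<alpha> by (intro pochhammer_pos) simp
      moreover have "pochhammer ?p n = of_real (pochhammer (\<alpha> + 2) n)"
        by (simp add: pochhammer_of_real add.commute flip: of_real_add)
      moreover have "(- w) ^ n = (-1) ^ n * w ^ n" by (rule power_minus)
      ultimately show ?thesis
        by (simp add: c_def gbinomial_pochhammer field_simps flip: power_mult_distrib)
    qed
    finally show ?thesis by simp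
  qed
  ultimately have "(\<lambda>n. (deriv ^^ n) F 0 / fact n * (w - 0) ^ n) sums (LINT z|?M. (\<Sum>n. c n * cnj z ^ n * F z))"
    by simp
  moreover have "(\<lambda>n. (deriv ^^ n) F 0 / fact n * (w - 0) ^ n) sums F w"
    using w by (intro holomorphic_power_series[OF F]) simp
  ultimately have "(LINT z|?M. (\<Sum>n. c n * cnj z ^ n * F z)) = F w"
    by (rule sums_unique2)
  moreover have "(LINT z|?M. (\<Sum>n. c n * cnj z ^ n * F z)) = (LINT z|?M. cnj ((1 - z * cnj w) powr (- ?p)) * F z)"
  proof (rule integral_cong_AE)
    show "AE z in ?M. (\<Sum>n. c n * cnj z ^ n * F z) = cnj ((1 - z * cnj w) powr (- ?p)) * F z"
      using AE_disc_measure by eventually_elim (auto dest!: sums sums_unique[symmetric])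
  qed measurable
  ultimately show ?thesis by simp
qed

section \<open>Slice extension\<close>

definition slice_incl :: "quat \<Rightarrow> complex \<Rightarrow> quat" where
  "slice_incl i z = of_real (Re z) + i * of_real (Im z)"

section \<open>Elementary facts on quaternions, their imaginary parts and units\<close>

lemma quat_of_real_sel [simp]:
  "qRe (of_real r) = r" "qI (of_real r) = 0" "qJ (of_real r) = 0" "qK (of_real r) = 0"
  by (simp_all add: of_real_def)

lemma bounded_linear_qcnj: "bounded_linear qcnj"
  by (intro linear_conv_bounded_linear[THEN iffD1] linearI) (simp_all add: quat_eq_iff)

lemma bounded_linear_qRe: "bounded_linear qRe"
  by (intro linear_conv_bounded_linear[THEN iffD1] linearI) simp_all

lemma norm_qcnj [simp]: "norm (qcnj x) = norm x"
  by (simp add: norm_quat_eq)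

lemma qcnj_qcnj [simp]: "qcnj (qcnj x) = x"
  by (simp add: quat_eq_iff)

lemma qcnj_of_real [simp]: "qcnj (of_real r) = of_real r"
  by (simp add: quat_eq_iff)

lemma qcnj_1 [simp]: "qcnj 1 = 1"
  by (simp add: quat_eq_iff)

lemma quat_norm_square: "(norm x)\<^sup>2 = (qRe x)\<^sup>2 + (qI x)\<^sup>2 + (qJ x)\<^sup>2 + (qK x)\<^sup>2"
  by (simp add: norm_quat_eq)

lemma qIm_norm_square: "(norm x)\<^sup>2 = (qRe x)\<^sup>2 + (qIm_norm x)\<^sup>2"
  by (simp add: qIm_norm_def quat_norm_square)

lemma norm_Complex_qIm_norm [simp]: "norm (Complex (qRe x) (qIm_norm x)) = norm x"
  by (simp add: cmod_def flip: qIm_norm_square)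

lemma qIm_norm_nonneg [simp]: "qIm_norm x \<ge> 0"
  by (simp add: qIm_norm_def)

text \<open>For real \<open>x\<close> this is 0 and not an imaginary unit. The decomposition
  \<open>qunit_eq\<close> and the bound \<open>norm_qunit_le\<close> therefore hold for all
  \<open>x\<close>.\<close>

definition qunit :: "quat \<Rightarrow> quat" where
  "qunit x = (x - of_real (qRe x)) /\<^sub>R qIm_norm x"

lemma qunit_eq: "x = of_real (qRe x) + qIm_norm x *\<^sub>R qunit x"
  by (cases "qIm_norm x = 0") (simp_all add: qunit_def qIm_norm_def)

lemma qunit_imag: "qIm_norm x \<noteq> 0 \<Longrightarrow> qunit x \<in> imag_units"
  by (simp add: qunit_def imag_units_def qIm_norm_def)

lemma norm_qunit_le: "norm (qunit x) \<le> 1"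
  by (cases "qIm_norm x = 0") (simp_all add: qunit_def flip: qIm_norm_def)

lemma
  assumes "(F has_derivative D) (at (Complex a b))"
  shows has_vector_derivative_horizontal: "((\<lambda>s. F (Complex s b)) has_vector_derivative D 1) (at a)"
    and has_vector_derivative_vertical: "((\<lambda>t. F (Complex a t)) has_vector_derivative D \<i>) (at b)"
proof -
  have lin: "linear D"
    using assms by (rule has_derivative_linear)
  have "((\<lambda>s. Complex s b) has_vector_derivative 1) (at a)" "((\<lambda>t. Complex a t) has_vector_derivative \<i>) (at b)"
    by (auto simp: has_vector_derivative_complex_iff)
  from this[unfolded has_vector_derivative_def, THEN has_derivative_compose, OF assms]
  show "((\<lambda>s. F (Complex s b)) has_vector_derivative D 1) (at a)"
    "((\<lambda>t. F (Complex a t)) has_vector_derivative D \<i>) (at b)"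
    unfolding has_vector_derivative_def by (simp_all only: linear_scale[OF lin])
qed

section \<open>The embedding of the complex numbers onto the slice and the projection back\<close>

locale slice_unit =
  fixes i :: quat
  assumes imag_unit: "i \<in> imag_units"
begin

abbreviation \<iota> :: "complex \<Rightarrow> quat" where "\<iota> \<equiv> slice_incl i"

lemma qRe_unit [simp]: "qRe i = 0" and norm_unit [simp]: "norm i = 1"
  using imag_unit by (auto simp: imag_units_def)

lemma unit_square_sum: "qI i * qI i + qJ i * qJ i + qK i * qK i = 1"
  using quat_norm_square[of i] by (simp add: power2_eq_square)

lemma unit_square [simp]: "i * i = -1"
  using unit_square_sum by (simp add: quat_eq_iff)

lemma unit_square_assoc [simp]: "i * (i * x) = - x"
  by (simp flip: mult.assoc)

lemma incl_scaleR: "\<iota> z = Re z *\<^sub>R 1 + Im z *\<^sub>R i"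
  by (simp add: slice_incl_def of_real_def)

lemma bounded_linear_incl: "bounded_linear \<iota>"
  by (intro linear_conv_bounded_linear[THEN iffD1] linearI) (simp_all add: incl_scaleR scaleR_add_left scaleR_add_right)

lemma incl_diff: "\<iota> (a - b) = \<iota> a - \<iota> b"
  and incl_minus: "\<iota> (- a) = - \<iota> a" and incl_0 [simp]: "\<iota> 0 = 0" 
  and incl_scale: "\<iota> (r *\<^sub>R a) = r *\<^sub>R \<iota> a"
  using bounded_linear.linear[OF bounded_linear_incl]
  by (simp_all add: linear_diff linear_neg linear_0 linear_scale)

lemma incl_1 [simp]: "\<iota> 1 = 1" and incl_of_real [simp]: "\<iota> (of_real r) = of_real r" and incl_ii [simp]: "\<iota> \<i> = i"
  by (simp_all add: slice_incl_def)

lemma incl_mult: "\<iota> (a * b) = \<iota> a * \<iota> b"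
  by (simp add: incl_scaleR algebra_simps)

lemma qcnj_incl: "qcnj (\<iota> a) = \<iota> (cnj a)"
  by (simp add: quat_eq_iff incl_scaleR)

lemma norm_incl [simp]: "norm (\<iota> a) = norm a"
proof -
  have "(norm (\<iota> a))\<^sup>2 = (Re a)\<^sup>2 + (Im a)\<^sup>2 * (qI i * qI i + qJ i * qJ i + qK i * qK i)"
    unfolding quat_norm_square by (simp add: incl_scaleR power2_eq_square algebra_simps)
  then have "(norm (\<iota> a))\<^sup>2 = (norm a)\<^sup>2"
    by (simp add: unit_square_sum cmod_power2)
  then show ?thesis by simp
qed

lemma qRe_incl [simp]: "qRe (\<iota> a) = Re a" and qIm_norm_incl [simp]: "qIm_norm (\<iota> a) = \<bar>Im a\<bar>"
  by (simp_all add: incl_scaleR qIm_norm_def of_real_def)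

lemma slice_plane_eq: "slice_plane i = range \<iota>"
proof (intro set_eqI iffI)
  fix x assume "x \<in> slice_plane i"
  then obtain a b where "x = \<iota> (Complex a b)"
    by (auto simp: slice_plane_def slice_incl_def)
  then show "x \<in> range \<iota>" by blast
qed (auto simp: slice_plane_def slice_incl_def)

lemma slice_disc_eq: "slice_disc i = \<iota> ` ball 0 1"
  by (auto simp: slice_disc_def slice_plane_eq)

text \<open>The first coordinate in the splitting H = C_i + C_i j, for an imaginary unit j
  orthogonal to i. Being left linear over the slice (\<open>complex_part_incl_mult\<close>), it
  turns slice holomorphic functions into holomorphic ones and commutes with left multiplication by
  slice-valued kernels.\<close>

definition complex_part :: "quat \<Rightarrow> complex" where
  "complex_part q = Complex (qRe q) (i \<bullet> q)"

lemma bounded_linear_complex_part: "bounded_linear complex_part"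
  by (intro linear_conv_bounded_linear[THEN iffD1] linearI)
    (simp_all add: complex_part_def complex_eq_iff inner_add_right)

lemma complex_part_incl_mult: "complex_part (\<iota> a * q) = a * complex_part q"
proof -
  let ?n = "qI i * qI i + qJ i * qJ i + qK i * qK i"
  have "i \<bullet> (\<iota> a * q) = Re a * (i \<bullet> q) + Im a * qRe q * ?n"
    by (simp add: incl_scaleR inner_quat_def algebra_simps)
  moreover have "qRe (\<iota> a * q) = Re a * qRe q - Im a * (i \<bullet> q)"
    by (simp add: incl_scaleR inner_quat_def algebra_simps)
  ultimately show ?thesis
    by (simp add: complex_part_def complex_eq_iff unit_square_sum)
qed

text \<open>Quaternionic identities that are left linear over the slice follow from complex ones.\<close>

lemma quat_eq_complex_partI:
  assumes "\<And>c. complex_part (x * c) = complex_part (y * c)"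
  shows "x = y"
proof -
  \<comment> \<open>The choice \<open>c = qcnj (x - y)\<close> makes the product the real number |x
    - y|^2, which the projection does not lose.\<close>
  have "complex_part ((x - y) * qcnj (x - y)) = 0"
    using assms by (simp add: left_diff_distrib bounded_linear.linear[OF bounded_linear_complex_part, THEN linear_diff])
  then have "(norm (x - y))\<^sup>2 = 0"
    by (simp add: mult_qcnj complex_part_def complex_eq_iff)
  then show ?thesis by simp
qed

text \<open>The Cauchy-Riemann equations for the complex structure given by left multiplication by
  \<open>i\<close>: a real linear map D with D(i h) = i D(h) has the form h \<mapsto>
  \<open>\<iota> h * d\<close> with d = D(1).\<close>

definition slice_holo :: "(complex \<Rightarrow> quat) \<Rightarrow> bool" where
  "slice_holo g \<longleftrightarrow> (\<forall>z\<in>ball 0 1. \<exists>d. (g has_derivative (\<lambda>h. \<iota> h * d)) (at z))"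

text \<open>The components u and v of a slice function, recovered from its values on one slice.
  There g(z) = u + i v and g(cnj z) = u - i v, so u is the mean of both values, and g(cnj z) - g(z)
  = -2 i v yields v after multiplication by i / 2.\<close>

definition even_part :: "(complex \<Rightarrow> quat) \<Rightarrow> complex \<Rightarrow> quat" where
  "even_part g z = (1/2) *\<^sub>R (g z + g (cnj z))"

definition odd_part :: "(complex \<Rightarrow> quat) \<Rightarrow> complex \<Rightarrow> quat" where
  "odd_part g z = (1/2) *\<^sub>R (i * (g (cnj z) - g z))"

text \<open>The representation formula: the components found on the slice of \<open>i\<close> are
  recombined with the imaginary unit of \<open>x\<close>. The value 0 outside the ball is the
  convention of \<open>slice_regular_space\<close>.\<close>

definition extend :: "(complex \<Rightarrow> quat) \<Rightarrow> quat \<Rightarrow> quat" where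
  "extend g x = (if norm x < 1 then even_part g (Complex (qRe x) (qIm_norm x))
     + qunit x * odd_part g (Complex (qRe x) (qIm_norm x)) else 0)"

lemma even_plus_odd: "even_part g z + i * odd_part g z = g z"
proof -
  have "even_part g z + i * odd_part g z = (1/2 + 1/2) *\<^sub>R g z"
    unfolding even_part_def odd_part_def scaleR_add_left by (simp add: algebra_simps)
  then show ?thesis by simp
qed

lemma even_part_cnj: "even_part g (cnj z) = even_part g z"
  and odd_part_cnj: "odd_part g (cnj z) = - odd_part g z"
  by (simp_all add: even_part_def odd_part_def algebra_simps)

lemma odd_part_real: "Im z = 0 \<Longrightarrow> odd_part g z = 0"
proof -
  assume "Im z = 0"
  then have "cnj z = z" by (simp add: complex_eq_iff)
  then show ?thesis by (simp add: odd_part_def)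
qed

text \<open>In the lower half plane two signs change together: \<open>\<iota> z\<close> has the unit
  \<open>- i\<close>, and the components are evaluated at \<open>cnj z\<close>, where the odd one is
  negated.\<close>

lemma extend_incl: "norm z < 1 \<Longrightarrow> extend g (\<iota> z) = g z"
proof -
  assume z: "norm z < 1"
  have im: "\<iota> z - of_real (Re z) = Im z *\<^sub>R i"
    by (simp add: incl_scaleR of_real_def)
  consider "Im z = 0" | "Im z > 0" | "Im z < 0" by linarith
  then show ?thesis
  proof cases
    case 1
    then have "Complex (Re z) \<bar>Im z\<bar> = z" by (simp add: complex_eq_iff)
    then show ?thesis
      using z 1 even_plus_odd[of g z] by (simp add: extend_def odd_part_real)
  next
    case 2
    then have "Complex (Re z) \<bar>Im z\<bar> = z" by (simp add: complex_eq_iff)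
    then show ?thesis
      using z 2 even_plus_odd[of g z] by (simp add: extend_def qunit_def im)
  next
    case 3
    then have "Complex (Re z) \<bar>Im z\<bar> = cnj z" by (simp add: complex_eq_iff)
    then show ?thesis
      using z 3 even_plus_odd[of g z]
      by (simp add: extend_def qunit_def im even_part_cnj odd_part_cnj)
  qed
qed

lemma extend_cong:
  assumes "\<And>z. norm z < 1 \<Longrightarrow> g z = h z"
  shows "extend g = extend h"
proof
  fix x
  show "extend g x = extend h x"
  proof (cases "norm x < 1")
    case True
    then show ?thesis
      using assms by (simp add: extend_def even_part_def odd_part_def)
  qed (simp add: extend_def)
qed

lemma extend_add: "extend (\<lambda>z. g z + h z) = (\<lambda>x. extend g x + extend h x)"
  by (rule ext) (simp add: extend_def even_part_def odd_part_def algebra_simps)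

lemma extend_mult: "extend (\<lambda>z. g z * c) = (\<lambda>x. extend g x * c)"
  by (rule ext) (simp add: extend_def even_part_def odd_part_def algebra_simps)

lemma slice_holo_add: "slice_holo g \<Longrightarrow> slice_holo h \<Longrightarrow> slice_holo (\<lambda>z. g z + h z)"
  unfolding slice_holo_def
proof (intro ballI)
  fix z :: complex
  assume gh: "\<forall>z\<in>ball 0 1. \<exists>d. (g has_derivative (\<lambda>h. \<iota> h * d)) (at z)"
    "\<forall>z\<in>ball 0 1. \<exists>d. (h has_derivative (\<lambda>h. \<iota> h * d)) (at z)" and z: "z \<in> ball 0 1"
  then obtain c d where "(g has_derivative (\<lambda>h. \<iota> h * c)) (at z)" "(h has_derivative (\<lambda>h. \<iota> h * d)) (at z)"
    by blast
  then have "((\<lambda>z. g z + h z) has_derivative (\<lambda>h. \<iota> h * (c + d))) (at z)"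
    by (auto intro!: derivative_eq_intros simp: distrib_left)
  then show "\<exists>d. ((\<lambda>z. g z + h z) has_derivative (\<lambda>h. \<iota> h * d)) (at z)" ..
qed

lemma slice_holo_mult: "slice_holo g \<Longrightarrow> slice_holo (\<lambda>z. g z * c)"
  unfolding slice_holo_def
proof (intro ballI)
  fix z :: complex
  assume g: "\<forall>z\<in>ball 0 1. \<exists>d. (g has_derivative (\<lambda>h. \<iota> h * d)) (at z)" and z: "z \<in> ball 0 1"
  then obtain d where "(g has_derivative (\<lambda>h. \<iota> h * d)) (at z)"
    by blast
  then have "((\<lambda>z. g z * c) has_derivative (\<lambda>h. \<iota> h * (d * c))) (at z)"
    by (auto intro!: derivative_eq_intros simp: mult.assoc)
  then show "\<exists>d. ((\<lambda>z. g z * c) has_derivative (\<lambda>h. \<iota> h * d)) (at z)" ..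
qed

lemma unit_incl_commute: "i * \<iota> a = \<iota> a * i"
  by (simp add: incl_scaleR algebra_simps)

text \<open>The unit \<open>i\<close> commutes with \<open>\<iota> h\<close>, so it can be absorbed
  into the derivative coefficient. This is what puts the function defining \<open>slice_J\<close>
  within reach of the extension.\<close>

lemma slice_holo_unit_mult: "slice_holo g \<Longrightarrow> slice_holo (\<lambda>z. i * g z)"
  unfolding slice_holo_def
proof (intro ballI)
  fix z :: complex
  assume g: "\<forall>z\<in>ball 0 1. \<exists>d. (g has_derivative (\<lambda>h. \<iota> h * d)) (at z)" and z: "z \<in> ball 0 1"
  then obtain d where "(g has_derivative (\<lambda>h. \<iota> h * d)) (at z)"
    by blast
  then have "((\<lambda>z. i * g z) has_derivative (\<lambda>h. \<iota> h * (i * d))) (at z)"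
    by (auto intro!: derivative_eq_intros simp: unit_incl_commute simp flip: mult.assoc)
  then show "\<exists>d. ((\<lambda>z. i * g z) has_derivative (\<lambda>h. \<iota> h * d)) (at z)" ..
qed

lemma slice_holo_incl:
  assumes "k holomorphic_on ball 0 1"
  shows "slice_holo (\<lambda>z. \<iota> (k z))"
  unfolding slice_holo_def
proof (intro ballI)
  fix z :: complex assume z: "z \<in> ball 0 1"
  then have "(k has_field_derivative deriv k z) (at z)"
    using assms holomorphic_derivI open_ball by blast
  then have "((\<lambda>z. \<iota> (k z)) has_derivative (\<lambda>h. \<iota> (deriv k z * h))) (at z)"
    unfolding has_field_derivative_def by (rule bounded_linear.has_derivative[OF bounded_linear_incl])
  moreover have "\<iota> (deriv k z * h) = \<iota> h * \<iota> (deriv k z)" for h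
    by (simp add: mult.commute flip: incl_mult)
  ultimately show "\<exists>d. ((\<lambda>z. \<iota> (k z)) has_derivative (\<lambda>h. \<iota> h * d)) (at z)" by auto
qed

lemma slice_holo_complex_part:
  assumes "slice_holo g"
  shows "(\<lambda>z. complex_part (g z * c)) holomorphic_on ball 0 1"
  unfolding holomorphic_on_open[OF open_ball]
proof (intro ballI)
  fix z :: complex assume "z \<in> ball 0 1"
  then obtain d where "(g has_derivative (\<lambda>h. \<iota> h * d)) (at z)"
    using assms unfolding slice_holo_def by blast
  then have "((\<lambda>z. complex_part (g z * c)) has_derivative (\<lambda>h. complex_part (\<iota> h * d * c))) (at z)"
    by (intro bounded_linear.has_derivative[OF bounded_linear_complex_part]) (auto intro!: derivative_eq_intros)
  moreover have "(\<lambda>h. complex_part (\<iota> h * d * c)) = (*) (complex_part (d * c))"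
    by (simp add: fun_eq_iff complex_part_incl_mult mult.assoc)
  ultimately have "((\<lambda>z. complex_part (g z * c)) has_field_derivative complex_part (d * c)) (at z)"
    unfolding has_field_derivative_def by simp
  then show "\<exists>f'. ((\<lambda>z. complex_part (g z * c)) has_field_derivative f') (at z)" ..
qed

text \<open>The Cauchy-Riemann system yields only the partial derivatives p + i q and - q + i p = i
  (p + i q); real differentiability of \<open>f\<close> supplies a total derivative, which they
  identify as left slice linear. The second claim says that \<open>f\<close> is determined by its
  values on the slice.\<close>

lemma hyperholomorphic_imp_slice_holo:
  assumes f: "f \<in> slice_regular_space"
  shows "slice_holo (\<lambda>z. f (\<iota> z))" and "f = extend (\<lambda>z. f (\<iota> z))"
proof -
  have "slice_hyperholomorphic f"
    using f by (simp add: slice_regular_space_def)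
  then obtain u v where diff: "f differentiable_on ball 0 1"
    and rep: "\<forall>x\<in>ball 0 1. \<forall>j\<in>imag_units. x = of_real (qRe x) + j * of_real (qIm_norm x) \<longrightarrow>
       f x = u (qRe x) (qIm_norm x) + j * v (qRe x) (qIm_norm x)"
    and cr: "\<forall>a b. a\<^sup>2 + b\<^sup>2 < 1 \<longrightarrow> u a b = u a (- b) \<and> v a b = - v a (- b) \<and>
           (\<exists>p q. ((\<lambda>s. u s b) has_vector_derivative p) (at a) \<and>
                  ((\<lambda>t. v a t) has_vector_derivative p) (at b) \<and>
                  ((\<lambda>s. v s b) has_vector_derivative q) (at a) \<and>
                  ((\<lambda>t. u a t) has_vector_derivative - q) (at b))"
    unfolding slice_hyperholomorphic_def by (elim conjE exE) (rule that)
  note rep = rep[rule_format] and cr = cr[rule_format]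
  have zero: "norm x \<ge> 1 \<Longrightarrow> f x = 0" for x
    using f by (auto simp: slice_regular_space_def)
  have disc: "norm z < 1 \<longleftrightarrow> (Re z)\<^sup>2 + (Im z)\<^sup>2 < 1" for z
    by (simp add: abs_square_less_1 flip: cmod_power2)
  have mi: "- i \<in> imag_units"
    by (simp add: imag_units_def)
  have fi: "f (\<iota> z) = u (Re z) (Im z) + i * v (Re z) (Im z)" if z: "norm z < 1" for z
  proof (cases "Im z \<ge> 0")
    case True
    then have "\<iota> z = of_real (qRe (\<iota> z)) + i * of_real (qIm_norm (\<iota> z))"
      by (subst slice_incl_def) simp
    from rep[OF _ imag_unit this] show ?thesis
      using z True by simp
  next
    case False
    \<comment> \<open>The components are tied to \<open>f\<close> only for nonnegative imaginary
      part, so the lower half plane is reached with the unit \<open>- i\<close>; the parities of u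
      and v then restore the sign.\<close>
    then have "\<iota> z = of_real (qRe (\<iota> z)) + - i * of_real (qIm_norm (\<iota> z))"
      by (subst slice_incl_def) simp
    from rep[OF _ mi this] have "f (\<iota> z) = u (Re z) (- Im z) + - i * v (Re z) (- Im z)"
      using z False by simp
    then show ?thesis
      using cr[of "Re z" "Im z"] z by (simp add: disc)
  qed
  show "slice_holo (\<lambda>z. f (\<iota> z))"
    unfolding slice_holo_def
  proof (intro ballI)
    fix z :: complex assume z: "z \<in> ball 0 1"
    define a b where "a = Re z" and "b = Im z"
    have zab: "z = Complex a b" by (simp add: a_def b_def)
    have ab: "a\<^sup>2 + b\<^sup>2 < 1" using z disc[of z] by (simp add: a_def b_def)
    have "f differentiable at (\<iota> z)"
      using diff z by (auto simp: differentiable_on_eq_differentiable_at)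
    then obtain f' where "(f has_derivative f') (at (\<iota> z))"
      by (auto simp: differentiable_def)
    then have D: "((\<lambda>z. f (\<iota> z)) has_derivative (\<lambda>h. f' (\<iota> h))) (at z)"
      using has_derivative_compose[OF bounded_linear_imp_has_derivative[OF bounded_linear_incl], of f f' z UNIV]
      by simp
    define D1 where "D1 h = f' (\<iota> h)" for h
    note D = D[folded D1_def]
    have lin: "linear D1"
      using D by (rule has_derivative_linear)
    obtain p q where
      der: "((\<lambda>s. u s b) has_vector_derivative p) (at a)" "((\<lambda>t. v a t) has_vector_derivative p) (at b)"
        "((\<lambda>s. v s b) has_vector_derivative q) (at a)" "((\<lambda>t. u a t) has_vector_derivative - q) (at b)"
      using cr[OF ab] by blast
    have "((\<lambda>s. f (\<iota> (Complex s b))) has_vector_derivative D1 1) (at a)"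
      using D[unfolded zab] by (rule has_vector_derivative_horizontal)
    moreover have "((\<lambda>s. f (\<iota> (Complex s b))) has_vector_derivative p + i * q) (at a)"
    proof (rule has_vector_derivative_transform_within_open)
      show "((\<lambda>s. u s b + i * v s b) has_vector_derivative p + i * q) (at a)"
        by (intro has_vector_derivative_add der bounded_linear.has_vector_derivative[OF bounded_linear_mult_right])
      show "open {s. s\<^sup>2 + b\<^sup>2 < 1}"
        by (intro open_Collect_less continuous_intros)
    qed (use ab in \<open>auto simp: fi disc\<close>)
    ultimately have D1: "D1 1 = p + i * q"
      by (rule vector_derivative_unique_at)
    have "((\<lambda>s. f (\<iota> (Complex a s))) has_vector_derivative D1 \<i>) (at b)"
      using D[unfolded zab] by (rule has_vector_derivative_vertical)
    moreover have "((\<lambda>s. f (\<iota> (Complex a s))) has_vector_derivative - q + i * p) (at b)"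
    proof (rule has_vector_derivative_transform_within_open)
      show "((\<lambda>s. u a s + i * v a s) has_vector_derivative - q + i * p) (at b)"
        by (intro has_vector_derivative_add der bounded_linear.has_vector_derivative[OF bounded_linear_mult_right])
      show "open {s. a\<^sup>2 + s\<^sup>2 < 1}"
        by (intro open_Collect_less continuous_intros)
    qed (use ab in \<open>auto simp: fi disc\<close>)
    ultimately have D2: "D1 \<i> = - q + i * p"
      by (rule vector_derivative_unique_at)
    have "D1 h = \<iota> h * (p + i * q)" for h
    proof -
      have "h = Re h *\<^sub>R 1 + Im h *\<^sub>R \<i>" by (simp add: complex_eq_iff)
      then have "D1 h = Re h *\<^sub>R D1 1 + Im h *\<^sub>R D1 \<i>"
        by (metis lin linear_add linear_scale)
      then show ?thesis
        by (simp add: D1 D2 incl_scaleR algebra_simps)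
    qed
    then show "\<exists>d. ((\<lambda>z. f (\<iota> z)) has_derivative (\<lambda>h. \<iota> h * d)) (at z)"
      using D by auto
  qed
  show "f = extend (\<lambda>z. f (\<iota> z))"
  proof
    fix x
    show "f x = extend (\<lambda>z. f (\<iota> z)) x"
    proof (cases "norm x < 1")
      case True
      define z where "z = Complex (qRe x) (qIm_norm x)"
      have z: "norm z < 1" using True by (simp add: z_def)
      have ab: "(qRe x)\<^sup>2 + (qIm_norm x)\<^sup>2 < 1"
        using z disc[of z] unfolding z_def complex.sel by blast
      have "f (\<iota> z) = u (qRe x) (qIm_norm x) + i * v (qRe x) (qIm_norm x)"
        "f (\<iota> (cnj z)) = u (qRe x) (qIm_norm x) - i * v (qRe x) (qIm_norm x)"
        using fi[of z] fi[of "cnj z"] z cr[OF ab] by (simp_all add: z_def)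
      moreover have "(p + i * q) + (p - i * q) = 2 *\<^sub>R p" "i * ((p - i * q) - (p + i * q)) = 2 *\<^sub>R q" for p q
        by (simp_all add: scaleR_2 right_diff_distrib distrib_left)
      ultimately have eo: "even_part (\<lambda>z. f (\<iota> z)) z = u (qRe x) (qIm_norm x)"
        "odd_part (\<lambda>z. f (\<iota> z)) z = v (qRe x) (qIm_norm x)"
        by (simp_all only: even_part_def odd_part_def scaleR_scaleR) simp_all
      show ?thesis
      proof (cases "qIm_norm x = 0")
        case True
        \<comment> \<open>At a real point \<open>qunit x\<close> is 0 and not admissible in the
          representation. The unit \<open>i\<close> is used instead, and the vanishing of v makes
          the two expressions agree.\<close>
        have "f x = u (qRe x) (qIm_norm x) + i * v (qRe x) (qIm_norm x)"
          using \<open>norm x < 1\<close> True qunit_eq[of x] by (intro rep imag_unit) auto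
        moreover have "v (qRe x) (qIm_norm x) = 0"
          using odd_part_real[of z "\<lambda>z. f (\<iota> z)"] eo True by (simp add: z_def)
        ultimately show ?thesis
          using \<open>norm x < 1\<close> by (simp add: extend_def eo flip: z_def)
      next
        case False
        have "f x = u (qRe x) (qIm_norm x) + qunit x * v (qRe x) (qIm_norm x)"
          using \<open>norm x < 1\<close> qunit_eq[of x] by (intro rep qunit_imag False) (simp_all add: of_real_def)
        then show ?thesis
          using \<open>norm x < 1\<close> by (simp add: extend_def eo flip: z_def)
      qed
    qed (simp add: zero extend_def)
  qed
qed

text \<open>Here c and d are the slice derivatives of \<open>g\<close> at z and at its conjugate.
  The coincidence c = d on the real axis is what makes the extension differentiable there.\<close>

lemma parts_derivativeE:
  assumes "slice_holo g" "norm z < 1"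
  obtains c d where 
    "(even_part g has_derivative (\<lambda>h. (1/2) *\<^sub>R (\<iota> h * c + \<iota> (cnj h) * d))) (at z)"
    "(odd_part g has_derivative (\<lambda>h. (1/2) *\<^sub>R (i * (\<iota> (cnj h) * d - \<iota> h * c)))) (at z)"
    "Im z = 0 \<Longrightarrow> c = d"
proof -
  obtain c where c: "(g has_derivative (\<lambda>h. \<iota> h * c)) (at z)"
    using assms that unfolding slice_holo_def by (meson mem_ball_0)
  obtain d where d: "(g has_derivative (\<lambda>h. \<iota> h * d)) (at (cnj z))" and cd: "Im z = 0 \<Longrightarrow> c = d"
  proof (cases "Im z = 0")
    case True
    then have "cnj z = z" by (simp add: complex_eq_iff)
    then show ?thesis using c by (intro that[of c]) auto
  next
    case False
    have "cnj z \<in> ball 0 1" using assms(2) by simp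
    then show ?thesis using assms(1) False that unfolding slice_holo_def by blast
  qed
  have d': "((\<lambda>z. g (cnj z)) has_derivative (\<lambda>h. \<iota> (cnj h) * d)) (at z)"
    using has_derivative_compose[OF bounded_linear_imp_has_derivative[OF bounded_linear_cnj] d] .
  show ?thesis
  proof (rule that)
    show "(even_part g has_derivative (\<lambda>h. (1/2) *\<^sub>R (\<iota> h * c + \<iota> (cnj h) * d))) (at z)"
      unfolding even_part_def[abs_def]
      by (intro has_derivative_scaleR_right has_derivative_add c d')
    show "(odd_part g has_derivative (\<lambda>h. (1/2) *\<^sub>R (i * (\<iota> (cnj h) * d - \<iota> h * c)))) (at z)"
      unfolding odd_part_def[abs_def]
      by (intro has_derivative_scaleR_right has_derivative_mult_right has_derivative_diff c d')
  qed (rule cd)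
qed


lemma extend_rep:
  assumes x: "norm x < 1" and j: "j \<in> imag_units" and xj: "x = of_real (qRe x) + j * of_real (qIm_norm x)"
  shows "extend g x = even_part g (Complex (qRe x) (qIm_norm x)) + j * odd_part g (Complex (qRe x) (qIm_norm x))"
proof (cases "qIm_norm x = 0")
  case True
  then show ?thesis using x by (simp add: extend_def odd_part_real)
next
  case False
  have "x - of_real (qRe x) = j * of_real (qIm_norm x)"
    by (subst (1) xj) simp
  then have "qunit x = j"
    using False by (simp add: qunit_def of_real_def)
  then show ?thesis using x by (simp add: extend_def)
qed

text \<open>Away from the real axis the formula is a composition of differentiable maps. At a real
  point \<open>qIm_norm\<close> and \<open>qunit\<close> fail to be differentiable, and the
  derivative y \<mapsto> y d is verified from the definition: the linear parts Re h d and Im h d of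
  the two components recombine to this map, and the error is at most the sum of their remainders
  because \<open>qunit\<close> has norm at most 1.\<close>

lemma extend_differentiable:
  assumes g: "slice_holo g" and x: "norm x < 1"
  shows "extend g differentiable at x"
proof -
  define C where "C x = Complex (qRe x) (qIm_norm x)" for x
  have nC: "norm (C y) = norm y" for y by (simp add: C_def)
  define F where "F y = even_part g (C y) + qunit y * odd_part g (C y)" for y
  have F: "extend g y = F y" if "norm y < 1" for y
    using that by (simp add: extend_def F_def C_def)
  obtain c d where
    ev: "(even_part g has_derivative (\<lambda>h. (1/2) *\<^sub>R (\<iota> h * c + \<iota> (cnj h) * d))) (at (C x))" and
    od: "(odd_part g has_derivative (\<lambda>h. (1/2) *\<^sub>R (i * (\<iota> (cnj h) * d - \<iota> h * c)))) (at (C x))" and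
    cd: "Im (C x) = 0 \<Longrightarrow> c = d"
    using parts_derivativeE[OF g, of "C x"] x by (auto simp: nC)
  have dRe: "qRe differentiable at y" for y
    using bounded_linear_qRe by (rule bounded_linear_imp_differentiable)
  have dOf: "(\<lambda>y. of_real (f y) :: 'b::real_normed_algebra_1) differentiable at y" if "f differentiable at y" for f :: "quat \<Rightarrow> real" and y
    using differentiable_compose[OF bounded_linear_imp_differentiable[OF bounded_linear_of_real] that] .
  show ?thesis
  proof (cases "qIm_norm x = 0")
    case False
    have dIm0: "(\<lambda>y. y - of_real (qRe y)) differentiable at x"
      by (intro differentiable_diff dOf dRe) simp
    have dIm: "qIm_norm differentiable at x"
    proof -
      have "norm differentiable at (x - of_real (qRe x))"
        using False by (intro differentiable_norm_at) (simp add: qIm_norm_def)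
      then show ?thesis
        unfolding qIm_norm_def[abs_def] using dIm0 by (rule differentiable_compose)
    qed
    have dC: "C differentiable at x"
    proof -
      have "C = (\<lambda>y. of_real (qRe y) + \<i> * of_real (qIm_norm y))"
        by (rule ext) (simp add: C_def complex_eq_iff)
      then show ?thesis
        by (simp only:) (intro differentiable_add differentiable_mult dOf dRe dIm differentiable_const)
    qed
    have "qunit differentiable at x"
      unfolding qunit_def[abs_def]
      by (intro differentiable_scaleR differentiable_inverse dIm dIm0 False)
    moreover have "(\<lambda>y. even_part g (C y)) differentiable at x" "(\<lambda>y. odd_part g (C y)) differentiable at x"
      by (rule differentiable_compose[OF differentiableI[OF ev] dC], rule differentiable_compose[OF differentiableI[OF od] dC])
    ultimately have "F differentiable at x"
      unfolding F_def[abs_def] by (intro differentiable_add differentiable_mult)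
    then obtain F' where "(F has_derivative F') (at x)"
      by (auto simp: differentiable_def)
    then have "(extend g has_derivative F') (at x)"
      by (rule has_derivative_transform_within_open[where s = "ball 0 1"]) (use x F in auto)
    then show ?thesis by (auto simp: differentiable_def)
  next
    case True
    define a where "a = qRe x"
    have xa: "x = of_real a" "C x = of_real a"
      using qunit_eq[of x] True by (simp_all add: a_def C_def complex_eq_iff)
    \<comment> \<open>The folding map \<open>C\<close> preserves distances to real points, so
      remainders relative to |C y - C x| are remainders relative to |y - x|.\<close>
    have Ca: "norm (C y - of_real a) = norm (y - of_real a)" for y
      using nC[of "y - of_real a"] by (simp add: C_def qIm_norm_def complex_eq_iff cmod_def)
    have c: "c = d" using cd True by (simp add: C_def)
    have half: "(1/2) *\<^sub>R (p + p) = p" for p :: quat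
      by (simp flip: scaleR_2)
    have ev': "(even_part g has_derivative (\<lambda>h. Re h *\<^sub>R d)) (at (C x))"
    proof -
      have "\<iota> h * d + \<iota> (cnj h) * d = Re h *\<^sub>R d + Re h *\<^sub>R d" for h
        by (simp add: incl_scaleR algebra_simps)
      then show ?thesis using ev by (simp add: c half)
    qed
    have od': "(odd_part g has_derivative (\<lambda>h. Im h *\<^sub>R d)) (at (C x))"
    proof -
      have "i * (\<iota> (cnj h) * d - \<iota> h * d) = Im h *\<^sub>R d + Im h *\<^sub>R d" for h
        by (simp add: incl_scaleR algebra_simps)
      then show ?thesis using od by (simp add: c half)
    qed
    define RE where "RE z = norm (even_part g z - even_part g (C x) - Re (z - C x) *\<^sub>R d) / norm (z - C x)" for z
    define RO where "RO z = norm (odd_part g z - odd_part g (C x) - Im (z - C x) *\<^sub>R d) / norm (z - C x)" for z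
    have lim: "(RE \<longlongrightarrow> 0) (at (C x))" "(RO \<longlongrightarrow> 0) (at (C x))"
      using ev' od' by (simp_all add: has_derivative_iff_norm RE_def[abs_def] RO_def[abs_def])
    \<comment> \<open>The remainders converge along punctured neighbourhoods, so \<open>C\<close>
      must also be seen to avoid the value \<open>C x\<close> away from \<open>x\<close>.\<close>
    have "filterlim C (at (C x)) (at x)"
      unfolding filterlim_at
    proof
      have "y = x" if "C y = C x" for y
        using Ca[of y] unfolding that xa(2) by (simp add: xa(1))
      then show "\<forall>\<^sub>F y in at x. C y \<in> UNIV \<and> C y \<noteq> C x"
        unfolding eventually_at_filter by (intro always_eventually) blast
      have "((\<lambda>y. norm (y - of_real a)) \<longlongrightarrow> norm (x - of_real a)) (at x)"
        by (intro tendsto_intros)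
      moreover have "norm (x - of_real a) = 0" by (simp add: xa(1))
      ultimately have "((\<lambda>y. norm (C y - of_real a)) \<longlongrightarrow> 0) (at x)"
        unfolding Ca by simp
      then show "(C \<longlongrightarrow> C x) (at x)"
        unfolding xa(2) by (subst Lim_null) (rule tendsto_norm_zero_cancel)
    qed
    then have limC: "((\<lambda>y. RE (C y) + RO (C y)) \<longlongrightarrow> 0) (at x)"
      using lim by (intro tendsto_add_zero) (auto intro: filterlim_compose)
    have "(extend g has_derivative (\<lambda>y. y * d)) (at x)"
      unfolding has_derivative_iff_norm
    proof
      show "bounded_linear (\<lambda>y. y * d)" by (rule bounded_linear_mult_left)
      show "((\<lambda>y. norm (extend g y - extend g x - (y - x) * d) / norm (y - x)) \<longlongrightarrow> 0) (at x)"
      proof (rule Lim_null_comparison[OF _ limC])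
        have "eventually (\<lambda>y. y \<in> ball 0 1) (at x)"
          using x by (intro eventually_at_in_open') auto
        then show "\<forall>\<^sub>F y in at x. norm (norm (extend g y - extend g x - (y - x) * d) / norm (y - x)) \<le> RE (C y) + RO (C y)"
        proof eventually_elim
          case (elim y)
          let ?E = "even_part g (C y) - even_part g (C x) - Re (C y - C x) *\<^sub>R d"
          let ?O = "odd_part g (C y) - odd_part g (C x) - Im (C y - C x) *\<^sub>R d"
          have Ox: "odd_part g (C x) = 0" by (rule odd_part_real) (simp add: xa(2))
          have "(y - x) * d = Re (C y - C x) *\<^sub>R d + qunit y * (Im (C y - C x) *\<^sub>R d)"
            unfolding xa(2) by (subst (1) qunit_eq[of y]) (simp add: xa(1) C_def algebra_simps of_real_def)
          then have "extend g y - extend g x - (y - x) * d = ?E + qunit y * ?O"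
            using elim x by (simp add: F F_def Ox algebra_simps)
          then have "norm (extend g y - extend g x - (y - x) * d) \<le> norm ?E + norm (qunit y) * norm ?O"
            by (metis norm_triangle_ineq norm_mult)
          also have "\<dots> \<le> norm ?E + norm ?O"
            by (intro add_left_mono mult_left_le_one_le norm_qunit_le) auto
          finally have "norm (extend g y - extend g x - (y - x) * d) / norm (y - x) \<le> (norm ?E + norm ?O) / norm (y - x)"
            by (rule divide_right_mono) simp
          moreover have "norm (C y - C x) = norm (y - x)"
            using Ca[of y] unfolding xa(2) by (simp add: xa(1))
          ultimately show ?case
            by (simp add: RE_def RO_def add_divide_distrib)
        qed
      qed
    qed
    then show ?thesis by (auto simp: differentiable_def)
  qed
qed

text \<open>Converse of \<open>hyperholomorphic_imp_slice_holo\<close>: every slice holomorphic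
  function on the disc is the restriction of an element of the space. It is the source of existence
  for \<open>slice_J\<close>, the kernel and the extremal vectors.\<close>

lemma extend_regular:
  assumes g: "slice_holo g"
  shows "extend g \<in> slice_regular_space"
proof -
  let ?u = "\<lambda>a b. even_part g (Complex a b)" and ?v = "\<lambda>a b. odd_part g (Complex a b)"
  have diff: "extend g differentiable_on ball 0 1"
    using extend_differentiable[OF g] by (simp add: differentiable_on_eq_differentiable_at)
  have zero: "\<forall>x. x \<notin> ball 0 1 \<longrightarrow> extend g x = 0"
    by (simp add: extend_def)
  have rep: "\<forall>x\<in>ball 0 1. \<forall>j\<in>imag_units. x = of_real (qRe x) + j * of_real (qIm_norm x) \<longrightarrow>
      extend g x = ?u (qRe x) (qIm_norm x) + j * ?v (qRe x) (qIm_norm x)"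
    by (intro ballI impI extend_rep) (simp_all only: mem_ball_0)
  have cr: "?u a b = ?u a (- b) \<and> ?v a b = - ?v a (- b) \<and>
           (\<exists>p q. ((\<lambda>s. ?u s b) has_vector_derivative p) (at a) \<and>
                  ((\<lambda>t. ?v a t) has_vector_derivative p) (at b) \<and>
                  ((\<lambda>s. ?v s b) has_vector_derivative q) (at a) \<and>
                  ((\<lambda>t. ?u a t) has_vector_derivative - q) (at b))" if ab: "a\<^sup>2 + b\<^sup>2 < 1" for a b
  proof -
    have cnj: "Complex a (- b) = cnj (Complex a b)" by (simp add: complex_eq_iff)
    have parity: "even_part g (Complex a b) = even_part g (Complex a (- b))"
      "odd_part g (Complex a b) = - odd_part g (Complex a (- b))"
      by (simp_all only: cnj even_part_cnj odd_part_cnj minus_minus)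
    have "norm (Complex a b) < 1"
      using ab by (simp add: cmod_def)
    then obtain c d where der:
      "(even_part g has_derivative (\<lambda>h. (1/2) *\<^sub>R (\<iota> h * c + \<iota> (cnj h) * d))) (at (Complex a b))"
      "(odd_part g has_derivative (\<lambda>h. (1/2) *\<^sub>R (i * (\<iota> (cnj h) * d - \<iota> h * c)))) (at (Complex a b))"
      by (rule parts_derivativeE[OF g]) (rule that)
    \<comment> \<open>Read off from the derivatives of the even and odd part in the directions 1 and
      \<open>\<i>\<close>, with \<open>\<iota> \<i> = i\<close>.\<close>
    let ?p = "(1/2) *\<^sub>R (c + d)" and ?q = "(1/2) *\<^sub>R (i * (d - c))"
    have "((\<lambda>s. even_part g (Complex s b)) has_vector_derivative ?p) (at a)"
      "((\<lambda>t. odd_part g (Complex a t)) has_vector_derivative ?p) (at b)"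
      "((\<lambda>s. odd_part g (Complex s b)) has_vector_derivative ?q) (at a)"
      "((\<lambda>t. even_part g (Complex a t)) has_vector_derivative - ?q) (at b)"
      using has_vector_derivative_horizontal[OF der(1)] has_vector_derivative_vertical[OF der(1)]
        has_vector_derivative_horizontal[OF der(2)] has_vector_derivative_vertical[OF der(2)]
      by (simp_all add: incl_minus algebra_simps)
    with parity show ?thesis
      by blast
  qed
  then have "slice_hyperholomorphic (extend g)"
    unfolding slice_hyperholomorphic_def
    by (intro conjI diff exI[of _ ?u] exI[of _ ?v] rep) blast
  then show ?thesis
    using zero by (simp add: slice_regular_space_def)
qed

lemma slice_regular_eqI:
  assumes "f \<in> slice_regular_space" "h \<in> slice_regular_space" "\<And>z. norm z < 1 \<Longrightarrow> f (\<iota> z) = h (\<iota> z)"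
  shows "f = h"
  using hyperholomorphic_imp_slice_holo(2)[OF assms(1)] hyperholomorphic_imp_slice_holo(2)[OF assms(2)]
    extend_cong[OF assms(3)] by simp

lemma slice_ext_eqI:
  assumes f: "f \<in> slice_regular_space" and eq: "\<And>z. norm z < 1 \<Longrightarrow> f (\<iota> z) = g (\<iota> z)"
  shows "slice_ext i g = f"
  unfolding slice_ext_def
proof (rule the_equality)
  show "f \<in> slice_regular_space \<and> (\<forall>z\<in>slice_disc i. f z = g z)"
    using f eq by (auto simp: slice_disc_eq)
  show "h = f" if "h \<in> slice_regular_space \<and> (\<forall>z\<in>slice_disc i. h z = g z)" for h
    using that f eq by (intro slice_regular_eqI) (auto simp: slice_disc_eq)
qed

section \<open>The operator J on the slice and closure under right linear combinations\<close>

lemma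
  assumes f: "f \<in> slice_regular_space"
  shows slice_J_regular: "slice_J i f \<in> slice_regular_space"
    and slice_J_incl: "norm z < 1 \<Longrightarrow> slice_J i f (\<iota> z) = i * f (\<iota> z)"
proof -
  have h: "extend (\<lambda>z. i * f (\<iota> z)) \<in> slice_regular_space"
    by (intro extend_regular slice_holo_unit_mult hyperholomorphic_imp_slice_holo(1) f)
  then have "slice_J i f = extend (\<lambda>z. i * f (\<iota> z))"
    unfolding slice_J_def by (rule slice_ext_eqI) (simp add: extend_incl)
  then show "slice_J i f \<in> slice_regular_space"
    "norm z < 1 \<Longrightarrow> slice_J i f (\<iota> z) = i * f (\<iota> z)"
    using h by (simp_all add: extend_incl)
qed

lemma slice_J_eqI:
  assumes "f \<in> slice_regular_space" "h \<in> slice_regular_space" "\<And>z. norm z < 1 \<Longrightarrow> h (\<iota> z) = i * f (\<iota> z)"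
  shows "slice_J i f = h"
  using assms by (intro slice_regular_eqI slice_J_regular) (auto simp: slice_J_incl)

lemma slice_regular_add:
  assumes "f \<in> slice_regular_space" "h \<in> slice_regular_space"
  shows "(\<lambda>x. f x + h x) \<in> slice_regular_space"
proof -
  have "(\<lambda>x. f x + h x) = extend (\<lambda>z. f (\<iota> z) + h (\<iota> z))"
    unfolding extend_add using hyperholomorphic_imp_slice_holo(2) assms by metis
  then show ?thesis
    using assms by (simp add: extend_regular slice_holo_add hyperholomorphic_imp_slice_holo(1))
qed

lemma slice_regular_mult:
  assumes "f \<in> slice_regular_space"
  shows "(\<lambda>x. f x * c) \<in> slice_regular_space"
proof -
  have "(\<lambda>x. f x * c) = extend (\<lambda>z. f (\<iota> z) * c)"
    unfolding extend_mult using hyperholomorphic_imp_slice_holo(2) assms by metis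
  then show ?thesis
    using assms by (simp add: extend_regular slice_holo_mult hyperholomorphic_imp_slice_holo(1))
qed

end

lemma slice_regular_borel_measurable:
  assumes "f \<in> slice_regular_space"
  shows "f \<in> borel_measurable borel"
proof -
  have "continuous_on (ball 0 1) f"
    using assms unfolding slice_regular_space_def slice_hyperholomorphic_def
    by (intro differentiable_imp_continuous_on) simp
  then have "(\<lambda>x. indicator (ball 0 1) x *\<^sub>R f x) \<in> borel_measurable borel"
    by (intro borel_measurable_continuous_on_indicator) auto
  moreover have "(\<lambda>x. indicator (ball 0 1) x *\<^sub>R f x) = f"
    using assms by (auto simp: slice_regular_space_def indicator_def)
  ultimately show ?thesis by simp
qed

section \<open>The slice Bergman space and its kernel\<close>

lemma qcnj_borel_measurable [measurable]: "qcnj \<in> borel_measurable borel"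
  using bounded_linear_qcnj by (intro borel_measurable_continuous_onI linear_continuous_on)

locale slice_bergman = slice_unit +
  fixes \<alpha> :: real
  assumes alpha: "\<alpha> > -1"
begin

abbreviation \<mu> :: "quat measure" where "\<mu> \<equiv> bergman_measure \<alpha> i"
abbreviation B :: "(quat \<Rightarrow> quat) set" where "B \<equiv> bergman_space \<alpha> i"
abbreviation ip :: "(quat \<Rightarrow> quat) \<Rightarrow> (quat \<Rightarrow> quat) \<Rightarrow> quat" where "ip \<equiv> bergman_inner \<alpha> i"
abbreviation N :: "(quat \<Rightarrow> quat) \<Rightarrow> real" where "N \<equiv> bergman_norm \<alpha> i"

lemma incl_borel_measurable [measurable]: "\<iota> \<in> borel_measurable borel"
  using bounded_linear_incl by (intro borel_measurable_continuous_onI linear_continuous_on)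

lemma bergman_measure_eq_distr: "\<mu> = distr (disc_measure \<alpha>) borel \<iota>"
proof -
  have "closed (range \<iota>)"
    using bounded_linear.linear[OF bounded_linear_incl]
    by (intro closed_subspace linear_subspace_image subspace_UNIV)
  then have [measurable]: "slice_disc i \<in> sets borel"
    by (simp add: slice_disc_def slice_plane_eq)
  have inv: "indicator (slice_disc i) (\<iota> z) = (indicator (ball 0 1) z :: ennreal)" for z
    by (simp add: slice_disc_def slice_plane_eq indicator_def)
  have eq: "(\<lambda>z. of_real (Re z) + i * of_real (Im z)) = \<iota>"
    by (simp add: slice_incl_def fun_eq_iff)
  show ?thesis
    unfolding bergman_measure_def slice_lebesgue_def disc_measure_def eq
    by (subst density_distr) (simp_all add: inv)
qed

lemma sets_bergman_measure [measurable_cong, simp]: "sets \<mu> = sets borel"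
  by (simp add: bergman_measure_eq_distr)

lemma space_bergman_measure [simp]: "space \<mu> = UNIV"
  by (simp add: bergman_measure_eq_distr)

lemma finite_measure_bergman: "finite_measure \<mu>"
  unfolding bergman_measure_eq_distr
  by (intro finite_measure.finite_measure_distr finite_measure_disc_measure alpha) simp

lemma integral_bergman_measure:
  fixes f :: "quat \<Rightarrow> 'b::{banach, second_countable_topology}"
  assumes "f \<in> borel_measurable borel"
  shows "(LINT z|\<mu>. f z) = (LINT z|disc_measure \<alpha>. f (\<iota> z))"
  unfolding bergman_measure_eq_distr using assms by (subst integral_distr) auto

lemma integrable_bergman_measure:
  fixes f :: "quat \<Rightarrow> 'b::{banach, second_countable_topology}"
  assumes "f \<in> borel_measurable borel"
  shows "integrable \<mu> f \<longleftrightarrow> integrable (disc_measure \<alpha>) (\<lambda>z. f (\<iota> z))"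
  unfolding bergman_measure_eq_distr using assms by (subst integrable_distr_eq) auto

section \<open>The right vector space and its quaternionic inner product\<close>

lemma bergman_spaceD:
  assumes "f \<in> B"
  shows "f \<in> slice_regular_space" "integrable \<mu> (\<lambda>z. (norm (f z))\<^sup>2)" "f \<in> borel_measurable borel"
  using assms slice_regular_borel_measurable by (auto simp: bergman_space_def)

lemma bergman_space_outside: "f \<in> B \<Longrightarrow> norm x \<ge> 1 \<Longrightarrow> f x = 0"
  by (auto simp: bergman_space_def slice_regular_space_def)

lemma bergman_space_add:
  assumes "f \<in> B" "g \<in> B"
  shows "(\<lambda>x. f x + g x) \<in> B"
proof -
  note [measurable] = bergman_spaceD(3)[OF assms(1)] bergman_spaceD(3)[OF assms(2)]
  have "integrable \<mu> (\<lambda>z. (norm (f z + g z))\<^sup>2)"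
  proof (rule Bochner_Integration.integrable_bound)
    show "integrable \<mu> (\<lambda>z. 2 * (norm (f z))\<^sup>2 + 2 * (norm (g z))\<^sup>2)"
      using assms[THEN bergman_spaceD(2)] by simp
    have "(norm (f z + g z))\<^sup>2 \<le> 2 * (norm (f z))\<^sup>2 + 2 * (norm (g z))\<^sup>2" for z
    proof -
      have "(norm (f z + g z))\<^sup>2 \<le> (norm (f z) + norm (g z))\<^sup>2"
        by (intro power_mono norm_triangle_ineq) simp
      also have "\<dots> \<le> 2 * (norm (f z))\<^sup>2 + 2 * (norm (g z))\<^sup>2"
        using sum_squares_ge_zero[of "norm (f z) - norm (g z)" 0] by (simp add: power2_eq_square algebra_simps)
      finally show ?thesis .
    qed
    then show "AE z in \<mu>. norm ((norm (f z + g z))\<^sup>2) \<le> norm (2 * (norm (f z))\<^sup>2 + 2 * (norm (g z))\<^sup>2)"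
      by simp
  qed simp
  then show ?thesis
    using slice_regular_add[of f g] assms by (simp add: bergman_space_def)
qed

lemma bergman_space_mult:
  assumes "f \<in> B"
  shows "(\<lambda>x. f x * c) \<in> B"
  using assms slice_regular_mult[of f c] by (simp add: bergman_space_def norm_mult power_mult_distrib)

lemma bergman_space_diff:
  assumes "f \<in> B" "g \<in> B"
  shows "(\<lambda>x. f x - g x) \<in> B"
  using bergman_space_add[OF assms(1) bergman_space_mult[OF assms(2), of "-1"]] by simp

lemma integrable_bergman_inner:
  assumes "f \<in> B" "g \<in> B"
  shows "integrable \<mu> (\<lambda>z. qcnj (f z) * g z)" "integrable \<mu> (\<lambda>z. norm (f z) * norm (g z))"
proof -
  note [measurable] = bergman_spaceD(3)[OF assms(1)] bergman_spaceD(3)[OF assms(2)]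
  have int: "integrable \<mu> (\<lambda>z. (norm (f z))\<^sup>2 + (norm (g z))\<^sup>2)"
    using assms[THEN bergman_spaceD(2)] by simp
  have *: "norm (f z) * norm (g z) \<le> (norm (f z))\<^sup>2 + (norm (g z))\<^sup>2" for z
  proof -
    have "2 * (norm (f z) * norm (g z)) \<le> (norm (f z))\<^sup>2 + (norm (g z))\<^sup>2"
      using sum_squares_bound[of "norm (f z)" "norm (g z)"] by (simp add: mult.assoc)
    moreover have "0 \<le> norm (f z) * norm (g z)" by simp
    ultimately show ?thesis by linarith
  qed
  show "integrable \<mu> (\<lambda>z. qcnj (f z) * g z)" "integrable \<mu> (\<lambda>z. norm (f z) * norm (g z))"
    by (rule Bochner_Integration.integrable_bound[OF int]; use * in \<open>simp add: norm_mult\<close>)+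
qed

lemma inner_add_right:
  assumes "f \<in> B" "g \<in> B" "h \<in> B"
  shows "ip f (\<lambda>x. g x + h x) = ip f g + ip f h"
  unfolding bergman_inner_def using assms
  by (simp add: distrib_left integrable_bergman_inner flip: Bochner_Integration.integral_add)

lemma inner_mult_right: "ip f (\<lambda>x. g x * c) = ip f g * c"
  if "f \<in> B" "g \<in> B"
  unfolding bergman_inner_def using integrable_bergman_inner(1)[OF that]
  by (simp flip: mult.assoc)

lemma inner_conj:
  assumes "f \<in> B" "g \<in> B"
  shows "ip g f = qcnj (ip f g)"
  unfolding bergman_inner_def
  by (subst integral_bounded_linear[OF bounded_linear_qcnj integrable_bergman_inner(1)[OF assms], symmetric])
    (simp add: qcnj_mult)

lemma inner_mult_left:
  assumes "f \<in> B" "g \<in> B"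
  shows "ip (\<lambda>x. f x * c) g = qcnj c * ip f g"
  using inner_conj[OF assms(2) bergman_space_mult[OF assms(1), of c]] inner_conj[OF assms(2,1)]
    inner_mult_right[OF assms(2,1), of c]
  by (simp add: qcnj_mult)

lemma inner_add_left:
  assumes "f \<in> B" "g \<in> B" "h \<in> B"
  shows "ip (\<lambda>x. f x + g x) h = ip f h + ip g h"
  using inner_conj[OF assms(3) bergman_space_add[OF assms(1,2)]] inner_conj[OF assms(3,1)]
    inner_conj[OF assms(3,2)] inner_add_right[OF assms(3,1,2)]
  by (simp add: bounded_linear.linear[OF bounded_linear_qcnj, THEN linear_add])

lemma inner_diff_right:
  assumes "f \<in> B" "g \<in> B" "h \<in> B"
  shows "ip f (\<lambda>x. g x - h x) = ip f g - ip f h"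
  using inner_add_right[OF assms(1,2) bergman_space_mult[OF assms(3), of "-1"]]
    inner_mult_right[OF assms(1,3), of "-1"] by simp

lemma inner_diff_left:
  assumes "f \<in> B" "g \<in> B" "h \<in> B"
  shows "ip (\<lambda>x. f x - g x) h = ip f h - ip g h"
  using inner_add_left[OF assms(1) bergman_space_mult[OF assms(2), of "-1"] assms(3)]
    inner_mult_left[OF assms(2,3), of "-1"] by (simp add: bounded_linear.linear[OF bounded_linear_qcnj, THEN linear_neg])

lemma inner_self:
  assumes "f \<in> B"
  shows "ip f f = of_real (LINT z|\<mu>. (norm (f z))\<^sup>2)"
  unfolding bergman_inner_def
  by (subst integral_bounded_linear[OF bounded_linear_of_real bergman_spaceD(2)[OF assms], symmetric])
    (simp add: mult_qcnj of_real_def)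

lemma norm_square: "f \<in> B \<Longrightarrow> (N f)\<^sup>2 = (LINT z|\<mu>. (norm (f z))\<^sup>2)"
  by (simp add: bergman_norm_def inner_self)

lemma inner_self_norm: "f \<in> B \<Longrightarrow> ip f f = of_real ((N f)\<^sup>2)"
  by (simp add: inner_self norm_square)

lemma bergman_norm_nonneg: "f \<in> B \<Longrightarrow> N f \<ge> 0"
  by (simp add: bergman_norm_def inner_self)

lemma bergman_norm_mult: "f \<in> B \<Longrightarrow> N (\<lambda>x. f x * c) = N f * norm c"
proof -
  assume f: "f \<in> B"
  have "(N (\<lambda>x. f x * c))\<^sup>2 = (N f * norm c)\<^sup>2"
    using f by (simp add: norm_square bergman_space_mult norm_mult power_mult_distrib)
  then show ?thesis
    using f by (simp add: bergman_norm_nonneg bergman_space_mult)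
qed

text \<open>The quaternionic integral is dominated by the integral \<open>X\<close> of the product
  of the pointwise norms. A real quadratic in t that is nonnegative for all t then bounds
  \<open>X\<close>, and no quaternionic scalar enters.\<close>

lemma inner_Cauchy_Schwarz:
  assumes f: "f \<in> B" and g: "g \<in> B"
  shows "norm (ip f g) \<le> N f * N g"
proof -
  define X where "X = (LINT z|\<mu>. norm (f z) * norm (g z))"
  have int: "integrable \<mu> (\<lambda>z. (norm (f z))\<^sup>2)" "integrable \<mu> (\<lambda>z. (norm (g z))\<^sup>2)"
    "integrable \<mu> (\<lambda>z. norm (f z) * norm (g z))"
    using f g by (simp_all add: bergman_spaceD integrable_bergman_inner)
  have quad: "0 \<le> t\<^sup>2 * (N f)\<^sup>2 + 2 * t * X + (N g)\<^sup>2" for t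
  proof -
    have "0 \<le> (LINT z|\<mu>. (t * norm (f z) + norm (g z))\<^sup>2)" by simp
    also have "\<dots> = (LINT z|\<mu>. t\<^sup>2 * (norm (f z))\<^sup>2 + 2 * t * (norm (f z) * norm (g z)) + (norm (g z))\<^sup>2)"
      by (simp add: power2_eq_square algebra_simps)
    also have "\<dots> = t\<^sup>2 * (N f)\<^sup>2 + 2 * t * X + (N g)\<^sup>2"
      using int f g by (simp add: norm_square X_def)
    finally show ?thesis .
  qed
  have "X\<^sup>2 \<le> (N f)\<^sup>2 * (N g)\<^sup>2"
  proof (cases "N f = 0")
    case True
    have "X = 0"
    proof (rule ccontr)
      assume "X \<noteq> 0"
      \<comment> \<open>When \<open>N f = 0\<close> this value of t makes the quadratic equal to
        -1.\<close>
      then show False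
        using quad[of "- ((N g)\<^sup>2 + 1) / (2 * X)"] True by (simp add: field_simps)
    qed
    then show ?thesis by simp
  next
    case False
    \<comment> \<open>The minimiser of the quadratic.\<close>
    have "0 \<le> (- X / (N f)\<^sup>2)\<^sup>2 * (N f)\<^sup>2 + 2 * (- X / (N f)\<^sup>2) * X + (N g)\<^sup>2"
      by (rule quad)
    also have "\<dots> = ((N f)\<^sup>2 * (N g)\<^sup>2 - X\<^sup>2) / (N f)\<^sup>2"
      using False by (simp add: field_simps power2_eq_square)
    finally show ?thesis
      using False by (simp add: zero_le_divide_iff)
  qed
  then have "X \<le> N f * N g"
    using f g power2_le_imp_le[of X "N f * N g"] by (simp add: power_mult_distrib bergman_norm_nonneg)
  moreover have "norm (ip f g) \<le> X"
    unfolding bergman_inner_def X_def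
    by (rule order_trans[OF integral_norm_bound]) (simp add: norm_mult)
  ultimately show ?thesis by linarith
qed

section \<open>The reproducing kernel\<close>

definition kern :: "complex \<Rightarrow> complex \<Rightarrow> complex" where
  "kern w z = (1 - z * cnj w) powr (- of_real (2 + \<alpha>))"

text \<open>Explicit candidate for the kernel at \<open>\<iota> w\<close>, indexed by a complex
  number; \<open>bergman_kernel_eq\<close> identifies it with the definite description.\<close>

definition K :: "complex \<Rightarrow> quat \<Rightarrow> quat" where
  "K w = extend (\<lambda>z. \<iota> (kern w z))"

lemma kern_re_pos:
  assumes "norm w < 1" "norm z < 1"
  shows "Re (1 - z * cnj w) > 0"
proof -
  have "norm (z * cnj w) < 1"
    using mult_strict_mono'[of "norm z" 1 "norm w" 1] assms by (simp add: norm_mult)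
  then show ?thesis
    using complex_Re_le_cmod[of "z * cnj w"] by (simp add: norm_mult)
qed

lemma norm_kern:
  assumes "norm w < 1" "norm z < 1"
  shows "norm (kern w z) = norm (1 - z * cnj w) powr (- (2 + \<alpha>))"
  unfolding kern_def by (subst norm_powr_real_powr') auto

lemma K_incl: "norm z < 1 \<Longrightarrow> K w (\<iota> z) = \<iota> (kern w z)"
  by (simp add: K_def extend_incl)

lemma K_outside: "norm x \<ge> 1 \<Longrightarrow> K w x = 0"
  by (simp add: K_def extend_def)

lemma K_regular: "norm w < 1 \<Longrightarrow> K w \<in> slice_regular_space"
  unfolding K_def kern_def
proof (intro extend_regular slice_holo_incl holomorphic_intros)
  fix z :: complex assume "norm w < 1" "z \<in> ball 0 1"
  then show "1 - z * cnj w \<notin> \<real>\<^sub>\<le>\<^sub>0"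
    using kern_re_pos[of w z] by (auto simp: complex_nonpos_Reals_iff)
qed

text \<open>For fixed w the kernel is bounded by (1 - |w|)^(-(2 + \<alpha>)), and the measure is
  finite.\<close>

lemma K_bergman:
  assumes w: "norm w < 1"
  shows "K w \<in> B"
proof -
  note [measurable] = slice_regular_borel_measurable[OF K_regular[OF w]]
  interpret finite_measure \<mu> by (rule finite_measure_bergman)
  have "norm (K w (\<iota> z)) \<le> (1 - norm w) powr (- (2 + \<alpha>))" for z
  proof (cases "norm z < 1")
    case True
    have "norm z * norm w \<le> 1 * norm w" using True by (intro mult_right_mono) auto
    then have "1 - norm w \<le> 1 - norm (z * cnj w)" by (simp add: norm_mult)
    also have "\<dots> \<le> norm (1 - z * cnj w)" using norm_triangle_ineq2[of 1 "z * cnj w"] by simp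
    finally have "norm (1 - z * cnj w) powr (- (2 + \<alpha>)) \<le> (1 - norm w) powr (- (2 + \<alpha>))"
      using alpha w by (intro powr_mono2') auto
    then show ?thesis using True w by (simp add: K_incl norm_kern)
  qed (simp add: K_outside)
  then have "AE z in disc_measure \<alpha>. norm ((norm (K w (\<iota> z)))\<^sup>2) \<le> ((1 - norm w) powr (- (2 + \<alpha>)))\<^sup>2"
    by (auto intro!: power_mono)
  from finite_measure.integrable_const_bound[OF finite_measure_disc_measure[OF alpha] this]
  have "integrable (disc_measure \<alpha>) (\<lambda>z. (norm (K w (\<iota> z)))\<^sup>2)"
    by simp
  then have "integrable \<mu> (\<lambda>z. (norm (K w z))\<^sup>2)"
    by (subst integrable_bergman_measure) auto
  then show ?thesis
    using K_regular[OF w] by (simp add: bergman_space_def)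
qed

text \<open>Right multiplication by c and the projection pass through the integral. The conjugated
  kernel, a slice-valued left factor, comes out of the projection as a complex number, which leaves
  the complex reproducing formula for the holomorphic function \<open>F\<close>.\<close>

lemma K_reproducing:
  assumes f: "f \<in> B" and w: "norm w < 1"
  shows "ip (K w) f = f (\<iota> w)"
proof (rule quat_eq_complex_partI)
  fix c
  note KB = K_bergman[OF w]
  note [measurable] = bergman_spaceD(3)[OF f] bergman_spaceD(3)[OF KB]
  interpret D: finite_measure "disc_measure \<alpha>" by (rule finite_measure_disc_measure[OF alpha])
  define F where "F z = complex_part (f (\<iota> z) * c)" for z
  have bl: "bounded_linear (\<lambda>x. complex_part (x * c))"
    using bounded_linear_compose[OF bounded_linear_complex_part bounded_linear_mult_left] .
  have hol: "F holomorphic_on ball 0 1"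
    unfolding F_def using bergman_spaceD(1)[OF f]
    by (intro slice_holo_complex_part hyperholomorphic_imp_slice_holo(1))
  \<comment> \<open>Over a finite measure, square integrability implies integrability through a
    \<le> 1 + a^2.\<close>
  have "integrable (disc_measure \<alpha>) (\<lambda>z. f (\<iota> z))"
  proof (rule Bochner_Integration.integrable_bound)
    show "integrable (disc_measure \<alpha>) (\<lambda>z. 1 + (norm (f (\<iota> z)))\<^sup>2)"
      using bergman_spaceD(2)[OF f] by (subst (asm) integrable_bergman_measure) auto
    have "a \<le> 1 + a\<^sup>2" for a :: real
      using sum_squares_bound[of a 1] zero_le_power2[of a] unfolding power_one mult_1_right by linarith
    then show "AE z in disc_measure \<alpha>. norm (f (\<iota> z)) \<le> norm (1 + (norm (f (\<iota> z)))\<^sup>2)"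
      by simp
  qed simp
  then have int: "integrable (disc_measure \<alpha>) F"
    unfolding F_def by (rule integrable_bounded_linear[OF bl])
  have "complex_part (ip (K w) f * c) = (LINT z|\<mu>. complex_part (qcnj (K w z) * f z * c))"
    unfolding bergman_inner_def
    by (rule integral_bounded_linear[OF bl integrable_bergman_inner(1)[OF KB f], symmetric])
  also have "\<dots> = (LINT z|disc_measure \<alpha>. complex_part (qcnj (K w (\<iota> z)) * f (\<iota> z) * c))"
  proof (rule integral_bergman_measure)
    have [measurable]: "(\<lambda>x. complex_part (x * c)) \<in> borel_measurable borel"
      using bl by (intro borel_measurable_continuous_onI linear_continuous_on)
    show "(\<lambda>z. complex_part (qcnj (K w z) * f z * c)) \<in> borel_measurable borel"
      by measurable
  qed
  also have "\<dots> = (LINT z|disc_measure \<alpha>. cnj (kern w z) * F z)"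
  proof (rule Bochner_Integration.integral_cong[OF refl])
    fix z
    show "complex_part (qcnj (K w (\<iota> z)) * f (\<iota> z) * c) = cnj (kern w z) * F z"
    proof (cases "norm z < 1")
      case True
      then show ?thesis by (simp add: K_incl qcnj_incl mult.assoc complex_part_incl_mult F_def)
    next
      case False
      then have "f (\<iota> z) = 0" using bergman_space_outside[OF f] by simp
      then show ?thesis
        by (simp add: F_def bounded_linear.linear[OF bounded_linear_complex_part, THEN linear_0])
    qed
  qed
  also have "\<dots> = F w"
    unfolding kern_def by (rule disc_reproducing[OF alpha hol int w])
  finally show "complex_part (ip (K w) f * c) = complex_part (f (\<iota> w) * c)"
    by (simp add: F_def)
qed

text \<open>Uniqueness: any competitor \<open>L\<close> satisfies L(z) = conj <L, K_z>, and <L, K_z>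
  = K_z(w) by its own reproducing property. The values on the slice are thus forced, and they
  determine \<open>L\<close>.\<close>

lemma bergman_kernel_eq:
  assumes w: "norm w < 1"
  shows "bergman_kernel \<alpha> i (\<iota> w) = K w"
  unfolding bergman_kernel_def
proof (rule the_equality)
  show "K w \<in> B \<and> (\<forall>f\<in>B. f (\<iota> w) = ip (K w) f)"
    using K_bergman[OF w] K_reproducing[OF _ w] by auto
  fix L assume L: "L \<in> B \<and> (\<forall>f\<in>B. f (\<iota> w) = ip L f)"
  show "L = K w"
  proof (rule slice_regular_eqI)
    fix z :: complex assume z: "norm z < 1"
    have "M (\<iota> z) = qcnj (ip M (K z))" if "M \<in> B" for M
      using K_reproducing[OF that z] inner_conj[OF that K_bergman[OF z]] by simp
    then show "L (\<iota> z) = K w (\<iota> z)"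
      using L K_bergman[OF w] K_bergman[OF z] K_reproducing[OF K_bergman[OF z] w] by metis
  qed (use L K_regular[OF w] bergman_spaceD in auto)
qed

lemma norm_K_square:
  assumes w: "norm w < 1"
  shows "(N (K w))\<^sup>2 = (1 - (norm w)\<^sup>2) powr (- (2 + \<alpha>))"
proof -
  have pos: "1 - (norm w)\<^sup>2 > 0" using w by (simp add: abs_square_less_1)
  have "of_real ((N (K w))\<^sup>2) = K w (\<iota> w)"
    using inner_self_norm[OF K_bergman[OF w]] K_reproducing[OF K_bergman[OF w] w] by simp
  also have "\<dots> = \<iota> (kern w w)" using w by (rule K_incl)
  also have "kern w w = of_real ((1 - (norm w)\<^sup>2) powr (- (2 + \<alpha>)))"
  proof -
    have "1 - w * cnj w = of_real (1 - (norm w)\<^sup>2)"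
      by (simp only: complex_norm_square of_real_diff of_real_1)
    then show ?thesis
      unfolding kern_def of_real_minus[symmetric] using pos by (simp only: powr_of_real less_imp_le)
  qed
  finally show ?thesis by (simp only: incl_of_real of_real_eq_iff)
qed

end

section \<open>The Lipschitz estimate\<close>

lemma quat_mult_of_real: "x * of_real r = r *\<^sub>R (x :: quat)"
  by (simp add: of_real_def)

lemma powr_minus_quotient:
  fixes a b d :: real
  assumes "a > 0" "b > 0" "d > 0"
  shows "d powr (- p) / (a powr (- p) * b powr (- p)) = (a * b / d) powr p"
  using assms by (simp add: powr_minus powr_mult powr_divide field_simps)

text \<open>The difference of the two sides, right minus left, has derivative p (x^(p - 1) - 1)
  \<le> 0 on (0, 1] and vanishes at 1.\<close>

lemma Bernoulli_powr:
  fixes y p :: real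
  assumes "0 < y" "y \<le> 1" "1 \<le> p"
  shows "1 - p * (1 - y) \<le> y powr p"
proof -
  have "y powr p - (1 - p * (1 - y)) \<ge> 1 powr p - (1 - p * (1 - 1))"
  proof (rule DERIV_nonpos_imp_nonincreasing[OF assms(2), where f = "\<lambda>y. y powr p - (1 - p * (1 - y))"])
    fix x assume x: "y \<le> x" "x \<le> 1"
    then have "((\<lambda>y. y powr p - (1 - p * (1 - y))) has_real_derivative p * (x powr (p - 1) - 1)) (at x)"
      using assms by (auto intro!: derivative_eq_intros simp: powr_diff algebra_simps)
    moreover have "x powr (p - 1) \<le> 1"
      using x assms powr_mono2[of "p - 1" x 1] by simp
    then have "p * (x powr (p - 1) - 1) \<le> 0"
      using assms by (simp add: mult_le_0_iff)
    ultimately show "\<exists>d. ((\<lambda>y. y powr p - (1 - p * (1 - y))) has_real_derivative d) (at x) \<and> d \<le> 0"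
      by blast
  qed
  then show ?thesis by simp
qed

text \<open>Twice the difference of the two sides vanishes at 0 and has derivative 2 x^2 / (1 -
  x^2).\<close>

lemma le_artanh:
  fixes r :: real
  assumes "0 \<le> r" "r < 1"
  shows "r \<le> 1 / 2 * ln ((1 + r) / (1 - r))"
proof -
  have "ln (1 + 0) - ln (1 - 0) - 2 * 0 \<le> ln (1 + r) - ln (1 - r) - 2 * r"
  proof (rule DERIV_nonneg_imp_nondecreasing[OF assms(1), where f = "\<lambda>r. ln (1 + r) - ln (1 - r) - 2 * r"])
    fix x assume x: "0 \<le> x" "x \<le> r"
    then have "((\<lambda>r. ln (1 + r) - ln (1 - r) - 2 * r) has_real_derivative 1 / (1 + x) + 1 / (1 - x) - 2) (at x)"
      using assms by (auto intro!: derivative_eq_intros)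
    moreover have "1 / (1 + x) + 1 / (1 - x) - 2 = 2 * x\<^sup>2 / ((1 + x) * (1 - x))"
      using x assms mult_strict_mono'[of x 1 x 1] by (simp add: field_simps power2_eq_square)
    moreover have "2 * x\<^sup>2 / ((1 + x) * (1 - x)) \<ge> 0"
      using x assms by simp
    ultimately show "\<exists>d. ((\<lambda>r. ln (1 + r) - ln (1 - r) - 2 * r) has_real_derivative d) (at x) \<and> 0 \<le> d"
      by metis
  qed
  then show ?thesis
    using assms by (simp add: ln_div)
qed

lemma one_minus_pseudohyperbolic_square:
  fixes z w :: complex
  assumes "norm z < 1" "norm w < 1"
  shows "1 - (norm (z - w) / norm (1 - z * cnj w))\<^sup>2
    = (1 - (norm z)\<^sup>2) * (1 - (norm w)\<^sup>2) / (norm (1 - z * cnj w))\<^sup>2"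
    and "norm (1 - z * cnj w) > 0"
proof -
  have "norm (z * cnj w) < 1"
    using mult_strict_mono'[of "norm z" 1 "norm w" 1] assms by (simp add: norm_mult)
  then show pos: "norm (1 - z * cnj w) > 0"
    by auto
  have "(norm (1 - z * cnj w))\<^sup>2 - (norm (z - w))\<^sup>2 = (1 - (norm z)\<^sup>2) * (1 - (norm w)\<^sup>2)"
    unfolding cmod_power2 by (simp add: power2_eq_square algebra_simps)
  then show "1 - (norm (z - w) / norm (1 - z * cnj w))\<^sup>2
    = (1 - (norm z)\<^sup>2) * (1 - (norm w)\<^sup>2) / (norm (1 - z * cnj w))\<^sup>2"
    using pos by (simp add: field_simps)
qed

section \<open>Normalised kernels and their inner products\<close>

context slice_bergman
begin

lemma pseudohyperbolic_incl: "pseudohyperbolic (\<iota> z) (\<iota> w) = norm (z - w) / norm (1 - z * cnj w)"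
proof -
  have "1 - \<iota> z * qcnj (\<iota> w) = \<iota> (1 - z * cnj w)"
    by (simp add: qcnj_incl incl_diff incl_mult)
  then show ?thesis
    by (simp add: pseudohyperbolic_def flip: incl_diff)
qed

lemma pseudohyperbolic_bounds:
  assumes "norm z < 1" "norm w < 1"
  shows "0 \<le> pseudohyperbolic (\<iota> z) (\<iota> w)" "pseudohyperbolic (\<iota> z) (\<iota> w) < 1"
proof -
  show nn: "0 \<le> pseudohyperbolic (\<iota> z) (\<iota> w)"
    by (simp add: pseudohyperbolic_def)
  have "0 < (1 - (norm z)\<^sup>2) * (1 - (norm w)\<^sup>2) / (norm (1 - z * cnj w))\<^sup>2"
    using assms one_minus_pseudohyperbolic_square(2)[OF assms]
    by (intro divide_pos_pos mult_pos_pos) (simp_all add: abs_square_less_1)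
  then have "(pseudohyperbolic (\<iota> z) (\<iota> w))\<^sup>2 < 1"
    using one_minus_pseudohyperbolic_square(1)[OF assms] by (simp add: pseudohyperbolic_incl)
  then show "pseudohyperbolic (\<iota> z) (\<iota> w) < 1"
    using nn by (simp add: abs_square_less_1)
qed

lemma norm_K_pos: "norm w < 1 \<Longrightarrow> N (K w) > 0"
proof -
  assume w: "norm w < 1"
  then have "1 - (norm w)\<^sup>2 > 0" by (simp add: abs_square_less_1)
  then have "(N (K w))\<^sup>2 > 0"
    unfolding norm_K_square[OF w] by simp
  then have "N (K w) \<noteq> 0" by auto
  then show ?thesis using bergman_norm_nonneg[OF K_bergman[OF w]] by simp
qed

text \<open>The real scaling in \<open>normalized_kernel\<close> is written as right multiplication
  by a real quaternion, so that the rules for right scalars apply to it.\<close>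

definition nk :: "complex \<Rightarrow> quat \<Rightarrow> quat" where
  "nk w = (\<lambda>x. K w x * of_real (inverse (N (K w))))"

lemma normalized_kernel_eq: "norm w < 1 \<Longrightarrow> normalized_kernel \<alpha> i (\<iota> w) = nk w"
  by (simp add: normalized_kernel_def nk_def bergman_kernel_eq quat_mult_of_real fun_eq_iff del: of_real_inverse)

lemma nk_bergman: "norm w < 1 \<Longrightarrow> nk w \<in> B"
  unfolding nk_def by (intro bergman_space_mult K_bergman)

lemma norm_nk: "norm w < 1 \<Longrightarrow> N (nk w) = 1"
  using norm_K_pos[of w] by (simp add: nk_def bergman_norm_mult K_bergman del: of_real_inverse)

lemma nk_reproducing: "f \<in> B \<Longrightarrow> norm w < 1 \<Longrightarrow> ip (nk w) f = inverse (N (K w)) *\<^sub>R f (\<iota> w)"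
  by (simp add: nk_def inner_mult_left K_bergman K_reproducing scaleR_conv_of_real del: of_real_inverse)

lemma nk_incl: "norm z < 1 \<Longrightarrow> nk w (\<iota> z) = \<iota> (inverse (N (K w)) *\<^sub>R kern w z)"
  unfolding incl_scale by (simp only: nk_def K_incl quat_mult_of_real)

text \<open>The inner product is K_w(z) divided by both norms, hence in the slice; its phase is a
  slice unit, which a Berezin transform commuting with \<open>i\<close> tolerates. The modulus
  follows from |1 - z cnj w|^2 (1 - \<rho>^2) = (1 - |z|^2) (1 - |w|^2).\<close>

lemma inner_nk:
  assumes z: "norm z < 1" and w: "norm w < 1"
  obtains c where "ip (nk z) (nk w) = \<iota> c"
    "(norm c)\<^sup>2 = (1 - (pseudohyperbolic (\<iota> z) (\<iota> w))\<^sup>2) powr (2 + \<alpha>)"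
proof
  let ?c = "(inverse (N (K z)) * inverse (N (K w))) *\<^sub>R kern w z"
  show "ip (nk z) (nk w) = \<iota> ?c"
    using z w by (simp add: nk_reproducing nk_bergman nk_incl incl_scale)
  let ?A = "1 - (norm z)\<^sup>2" and ?B = "1 - (norm w)\<^sup>2" and ?D = "norm (1 - z * cnj w)"
  have pos: "?A > 0" "?B > 0" "?D > 0"
    using z w one_minus_pseudohyperbolic_square(2)[OF z w] by (simp_all add: abs_square_less_1)
  have "(norm ?c)\<^sup>2 = (?D powr (- (2 + \<alpha>)))\<^sup>2 / ((N (K z))\<^sup>2 * (N (K w))\<^sup>2)"
    by (simp add: norm_kern[OF w z] power_mult_distrib divide_inverse power_inverse)
  also have "\<dots> = (?D\<^sup>2) powr (- (2 + \<alpha>)) / (?A powr (- (2 + \<alpha>)) * ?B powr (- (2 + \<alpha>)))"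
    unfolding norm_K_square[OF z] norm_K_square[OF w] using pos
    by (simp add: power2_eq_square powr_mult)
  also have "\<dots> = (?A * ?B / ?D\<^sup>2) powr (2 + \<alpha>)"
    using pos by (intro powr_minus_quotient) auto
  also have "?A * ?B / ?D\<^sup>2 = 1 - (pseudohyperbolic (\<iota> z) (\<iota> w))\<^sup>2"
    unfolding pseudohyperbolic_incl by (rule one_minus_pseudohyperbolic_square(1)[OF z w, symmetric])
  finally show "(norm ?c)\<^sup>2 = (1 - (pseudohyperbolic (\<iota> z) (\<iota> w))\<^sup>2) powr (2 + \<alpha>)" .
qed

section \<open>Bounded right linear operators and their quadratic forms\<close>

context
  fixes T
  assumes T: "bounded_right_linear \<alpha> i T"
begin

lemma op_bergman: "f \<in> B \<Longrightarrow> T f \<in> B"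
  and op_add: "f \<in> B \<Longrightarrow> g \<in> B \<Longrightarrow> T (\<lambda>x. f x + g x) = (\<lambda>x. T f x + T g x)"
  and op_mult: "f \<in> B \<Longrightarrow> T (\<lambda>x. f x * c) = (\<lambda>x. T f x * c)"
  using T by (auto simp: bounded_right_linear_def)

lemma op_diff:
  assumes "f \<in> B" "g \<in> B"
  shows "T (\<lambda>x. f x - g x) = (\<lambda>x. T f x - T g x)"
  using op_add[OF assms(1) bergman_space_mult[OF assms(2), of "-1"]] op_mult[OF assms(2), of "-1"]
  by simp

lemma op_norm_upper:
  assumes "f \<in> B" "N f \<le> 1"
  shows "N (T f) \<le> operator_norm \<alpha> i T"
proof -
  obtain b where b: "\<And>f. f \<in> B \<Longrightarrow> N (T f) \<le> b * N f"
    using T unfolding bounded_right_linear_def by blast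
  \<comment> \<open>The definition of boundedness fixes no sign for \<open>b\<close>, hence the
    absolute value.\<close>
  have "N (T g) \<le> \<bar>b\<bar>" if "g \<in> B" "N g \<le> 1" for g
  proof -
    have "N (T g) \<le> \<bar>b\<bar> * N g"
      using b[OF that(1)] bergman_norm_nonneg[OF that(1)] by (meson abs_ge_self mult_right_mono order_trans)
    also have "\<dots> \<le> \<bar>b\<bar>"
      using that by (intro mult_left_le) auto
    finally show ?thesis .
  qed
  then show ?thesis
    unfolding operator_norm_def using assms
    by (intro cSUP_upper2[where x = f] bdd_aboveI[where M = "\<bar>b\<bar>"]) auto
qed

lemma op_norm_bound:
  assumes f: "f \<in> B"
  shows "N (T f) \<le> operator_norm \<alpha> i T * N f"
proof (cases "N f = 0")
  case True
  \<comment> \<open>A function of norm 0 cannot be normalised; boundedness gives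
    \<open>N (T f) \<le> 0\<close> directly.\<close>
  obtain b where "N (T f) \<le> b * N f"
    using T f by (auto simp: bounded_right_linear_def)
  then show ?thesis using True by simp
next
  case False
  then have pos: "N f > 0" using bergman_norm_nonneg[OF f] by simp
  have "N (\<lambda>x. f x * of_real (inverse (N f))) = 1"
    using pos f by (simp add: bergman_norm_mult del: of_real_inverse)
  then have "N (T (\<lambda>x. f x * of_real (inverse (N f)))) \<le> operator_norm \<alpha> i T"
    using f by (intro op_norm_upper bergman_space_mult) auto
  then have "N (T f) * inverse (N f) \<le> operator_norm \<alpha> i T"
    using f pos by (simp add: op_mult bergman_norm_mult op_bergman norm_inverse)
  then show ?thesis
    using pos by (simp add: field_simps)
qed

text \<open>Polarisation: \<open>2 (\<langle>a, T a\<rangle> - \<langle>b, T b\<rangle>) = \<langle>a + b, T (a - b)\<rangle> + \<langle>a - b, T (a + b)\<rangle>\<close>, and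
  \<open>\<parallel>a \<plusminus> b\<parallel>\<^sup>2 = 2 \<plusminus> 2 c\<close> when \<open>\<langle>a, b\<rangle> = c\<close> is real.\<close>

lemma op_form_diff_le:
  assumes a: "a \<in> B" "N a = 1" and b: "b \<in> B" "N b = 1" and c: "ip a b = of_real c"
  shows "norm (ip a (T a) - ip b (T b)) \<le> 2 * operator_norm \<alpha> i T * sqrt (1 - c\<^sup>2)"
proof -
  let ?s = "\<lambda>x. a x + b x" and ?d = "\<lambda>x. a x - b x"
  note mem = a(1) b(1) op_bergman[OF a(1)] op_bergman[OF b(1)] bergman_space_add[OF a(1) b(1)]
    bergman_space_diff[OF a(1) b(1)]
  have ba: "ip b a = of_real c"
    using inner_conj[OF a(1) b(1)] c by simp
  have self: "ip a a = 1" "ip b b = 1"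
    using a b by (simp_all add: inner_self_norm)
  have "ip ?s (T ?d) + ip ?d (T ?s) = 2 *\<^sub>R (ip a (T a) - ip b (T b))"
    unfolding op_add[OF a(1) b(1)] op_diff[OF a(1) b(1)] using mem
    by (simp add: inner_add_left inner_diff_left inner_add_right inner_diff_right bergman_space_add
        bergman_space_diff scaleR_2)
  then have "2 * norm (ip a (T a) - ip b (T b)) = norm (ip ?s (T ?d) + ip ?d (T ?s))"
    by simp
  also have "\<dots> \<le> norm (ip ?s (T ?d)) + norm (ip ?d (T ?s))"
    by (rule norm_triangle_ineq)
  also have "\<dots> \<le> N ?s * N (T ?d) + N ?d * N (T ?s)"
    using mem by (intro add_mono inner_Cauchy_Schwarz op_bergman)
  also have "\<dots> \<le> N ?s * (operator_norm \<alpha> i T * N ?d) + N ?d * (operator_norm \<alpha> i T * N ?s)"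
    using mem by (intro add_mono mult_left_mono op_norm_bound bergman_norm_nonneg)
  also have "\<dots> = 2 * operator_norm \<alpha> i T * (N ?s * N ?d)"
    by simp
  also have "N ?s * N ?d = 2 * sqrt (1 - c\<^sup>2)"
  proof -
    have "ip ?s ?s = of_real (1 + c + (c + 1))" "ip ?d ?d = of_real (1 - c - (c - 1))"
      by (simp_all only: mem inner_add_left inner_diff_left inner_add_right inner_diff_right c ba self
          of_real_add of_real_diff of_real_1)
    then have "(N ?s)\<^sup>2 = 1 + c + (c + 1)" "(N ?d)\<^sup>2 = 1 - c - (c - 1)"
      using mem inner_self_norm by (metis of_real_eq_iff)+
    then have "(N ?s)\<^sup>2 = 2 + 2 * c" "(N ?d)\<^sup>2 = 2 - 2 * c"
      by simp_all
    then have "N ?s = sqrt (2 + 2 * c)" "N ?d = sqrt (2 - 2 * c)"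
      using mem by (metis bergman_norm_nonneg real_sqrt_abs abs_of_nonneg)+
    then have "N ?s * N ?d = sqrt ((2 + 2 * c) * (2 - 2 * c))"
      by (simp only: real_sqrt_mult)
    also have "(2 + 2 * c) * (2 - 2 * c) = 2\<^sup>2 * (1 - c\<^sup>2)"
      by (simp add: power2_eq_square algebra_simps)
    finally show ?thesis
      unfolding real_sqrt_mult by simp
  qed
  finally show ?thesis by simp
qed

end

section \<open>The Berezin transform and the upper bound\<close>

lemma berezin_eq:
  "norm z < 1 \<Longrightarrow> berezin \<alpha> i T (\<iota> z) = ip (nk z) (T (nk z))"
  by (simp add: berezin_def normalized_kernel_eq)

text \<open>By right linearity, J k_z = k_z i turns commutation with J into (T k_z) i = J (T k_z).
  Evaluated at z this says that i commutes with (T k_z)(z), of which the Berezin transform is a real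
  multiple.\<close>

lemma berezin_unit_commute:
  assumes T: "T \<in> operators_commuting_J \<alpha> i" and z: "norm z < 1"
  shows "berezin \<alpha> i T (\<iota> z) * i = i * berezin \<alpha> i T (\<iota> z)"
proof -
  note k = nk_bergman[OF z]
  have bl: "bounded_right_linear \<alpha> i T" and comm: "T (slice_J i (nk z)) = slice_J i (T (nk z))"
    using T k by (auto simp: operators_commuting_J_def)
  have "slice_J i (nk z) = (\<lambda>x. nk z x * i)"
    using k by (intro slice_J_eqI bergman_spaceD(1) bergman_space_mult) (simp_all add: nk_incl unit_incl_commute)
  then have "(\<lambda>x. T (nk z) x * i) = slice_J i (T (nk z))"
    using comm op_mult[OF bl k] by simp
  then have "T (nk z) (\<iota> z) * i = i * T (nk z) (\<iota> z)"
    using slice_J_incl[OF bergman_spaceD(1)[OF op_bergman[OF bl k]] z] by metis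
  then show ?thesis
    using z by (simp add: berezin_eq nk_reproducing op_bergman[OF bl k])
qed

lemma commute_incl: "q * i = i * q \<Longrightarrow> q * \<iota> a = \<iota> a * q"
  by (simp add: incl_scaleR distrib_left distrib_right)

lemma berezin_Lipschitz:
  assumes T: "T \<in> operators_commuting_J \<alpha> i" and z: "norm z < 1" and w: "norm w < 1"
  shows "norm (berezin \<alpha> i T (\<iota> z) - berezin \<alpha> i T (\<iota> w))
    \<le> 2 * sqrt (2 + \<alpha>) * operator_norm \<alpha> i T * bergman_metric (\<iota> z) (\<iota> w)"
proof -
  define r where "r = pseudohyperbolic (\<iota> z) (\<iota> w)"
  have r: "0 \<le> r" "r < 1"
    unfolding r_def using pseudohyperbolic_bounds[OF z w] by auto
  then have r2: "r\<^sup>2 < 1" by (simp add: abs_square_less_1)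
  have bl: "bounded_right_linear \<alpha> i T"
    using T by (simp add: operators_commuting_J_def)
  have nonneg: "operator_norm \<alpha> i T \<ge> 0"
    using op_norm_upper[OF bl nk_bergman[OF z]] bergman_norm_nonneg[OF op_bergman[OF bl nk_bergman[OF z]]]
    by (simp add: norm_nk[OF z])
  obtain c where c: "ip (nk z) (nk w) = \<iota> c" and nc: "(norm c)\<^sup>2 = (1 - r\<^sup>2) powr (2 + \<alpha>)"
    using inner_nk[OF z w] unfolding r_def by metis
  \<comment> \<open>The kernels are never orthogonal because \<rho> < 1, so the phase of
    \<open>c\<close> is defined.\<close>
  have c0: "c \<noteq> 0"
    using nc r2 by auto
  \<comment> \<open>The conjugate phase of \<open>c\<close>: as a right factor on k_w it makes the
    inner product equal to |c|.\<close>
  define u where "u = \<iota> (cnj c / of_real (norm c))"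
  have nu: "norm u = 1"
    using c0 by (simp add: u_def norm_divide)
  let ?b = "\<lambda>x. nk w x * u"
  have b: "?b \<in> B" "N ?b = 1"
    using w nu by (simp_all add: bergman_space_mult bergman_norm_mult nk_bergman norm_nk)
  have "ip (nk z) ?b = \<iota> c * u"
    using z w by (simp add: inner_mult_right nk_bergman c)
  also have "\<dots> = of_real (norm c)"
  proof -
    have "c * (cnj c / of_real (norm c)) = of_real (norm c)"
      using c0 by (simp add: complex_norm_square[symmetric] power2_eq_square)
    then show ?thesis by (simp add: u_def flip: incl_mult)
  qed
  finally have real: "ip (nk z) ?b = of_real (norm c)" .
  \<comment> \<open>This is where commutation with J enters: conj(u) q u = q for the Berezin value
    q, so rotating k_w leaves the form unchanged.\<close>
  have "berezin \<alpha> i T (\<iota> w) * u = u * berezin \<alpha> i T (\<iota> w)"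
    unfolding u_def by (intro commute_incl berezin_unit_commute T w)
  then have "ip ?b (T ?b) = berezin \<alpha> i T (\<iota> w)"
    using w nu op_bergman[OF bl nk_bergman[OF w]]
    by (simp add: op_mult[OF bl] nk_bergman inner_mult_left inner_mult_right bergman_space_mult berezin_eq
        mult.assoc) (simp add: mult_qcnj flip: mult.assoc)
  then have "norm (berezin \<alpha> i T (\<iota> z) - berezin \<alpha> i T (\<iota> w)) \<le> 2 * operator_norm \<alpha> i T * sqrt (1 - (norm c)\<^sup>2)"
    using op_form_diff_le[OF bl nk_bergman[OF z] norm_nk[OF z] b real] z by (simp add: berezin_eq)
  also have "\<dots> \<le> 2 * operator_norm \<alpha> i T * (sqrt (2 + \<alpha>) * bergman_metric (\<iota> z) (\<iota> w))"
  proof (rule mult_left_mono)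
    \<comment> \<open>Bernoulli at y = 1 - r^2 with exponent 2 + \<alpha> gives 1 - |c|^2 \<le> (2 +
      \<alpha>) r^2.\<close>
    have "sqrt (1 - (norm c)\<^sup>2) \<le> sqrt ((2 + \<alpha>) * r\<^sup>2)"
      using Bernoulli_powr[of "1 - r\<^sup>2" "2 + \<alpha>"] r2 alpha by (simp add: nc)
    also have "\<dots> = sqrt (2 + \<alpha>) * r"
      using r by (simp add: real_sqrt_mult)
    also have "\<dots> \<le> sqrt (2 + \<alpha>) * bergman_metric (\<iota> z) (\<iota> w)"
      unfolding bergman_metric_def r_def[symmetric] using r alpha by (intro mult_left_mono le_artanh) auto
    finally show "sqrt (1 - (norm c)\<^sup>2) \<le> sqrt (2 + \<alpha>) * bergman_metric (\<iota> z) (\<iota> w)" .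
  qed (use nonneg in simp)
  finally show ?thesis
    by (simp add: mult_ac)
qed

end

section \<open>Sharpness\<close>

context slice_bergman
begin

section \<open>The action of J on inner products\<close>

lemma slice_J_bergman:
  assumes f: "f \<in> B"
  shows "slice_J i f \<in> B"
proof -
  note J = slice_J_regular[OF bergman_spaceD(1)[OF f]]
  note [measurable] = bergman_spaceD(3)[OF f] slice_regular_borel_measurable[OF J]
  have "norm (slice_J i f (\<iota> z)) = norm (f (\<iota> z))" for z
  proof (cases "norm z < 1")
    case True
    then show ?thesis using slice_J_incl[OF bergman_spaceD(1)[OF f] True] by (simp add: norm_mult)
  next
    case False
    then show ?thesis using J bergman_spaceD(1)[OF f] by (simp add: slice_regular_space_def)
  qed
  then have "integrable \<mu> (\<lambda>z. (norm (slice_J i f z))\<^sup>2) \<longleftrightarrow> integrable \<mu> (\<lambda>z. (norm (f z))\<^sup>2)"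
    by (simp add: integrable_bergman_measure)
  then show ?thesis
    using J bergman_spaceD(2)[OF f] by (simp add: bergman_space_def)
qed

text \<open>Conjugates of slice values commute with \<open>i\<close>, which can therefore be pulled
  out on the left. For the exchange operator, the factor \<open>i\<close> in each coefficient then
  passes back through the slice-valued vector, which gives commutation with J.\<close>

lemma inner_slice_J:
  assumes e: "e \<in> B" "\<And>z. norm z < 1 \<Longrightarrow> e (\<iota> z) = \<iota> (k z)" and f: "f \<in> B"
  shows "ip e (slice_J i f) = i * ip e f"
proof -
  note [measurable] = bergman_spaceD(3)[OF f] bergman_spaceD(3)[OF e(1)] bergman_spaceD(3)[OF slice_J_bergman[OF f]]
  have "ip e (slice_J i f) = (LINT z|disc_measure \<alpha>. qcnj (e (\<iota> z)) * slice_J i f (\<iota> z))"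
    unfolding bergman_inner_def by (rule integral_bergman_measure) measurable
  also have "\<dots> = (LINT z|disc_measure \<alpha>. i * (qcnj (e (\<iota> z)) * f (\<iota> z)))"
  proof (rule Bochner_Integration.integral_cong[OF refl])
    fix z
    show "qcnj (e (\<iota> z)) * slice_J i f (\<iota> z) = i * (qcnj (e (\<iota> z)) * f (\<iota> z))"
    proof (cases "norm z < 1")
      case True
      then show ?thesis
        using slice_J_incl[OF bergman_spaceD(1)[OF f] True]
        by (simp add: e(2) qcnj_incl unit_incl_commute flip: mult.assoc)
    next
      case False
      then show ?thesis
        using bergman_space_outside[OF f] bergman_space_outside[OF slice_J_bergman[OF f]] by simp
    qed
  qed
  also have "\<dots> = (LINT z|\<mu>. i * (qcnj (e z) * f z))"
    by (rule integral_bergman_measure[symmetric]) measurable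
  also have "\<dots> = i * ip e f"
    unfolding bergman_inner_def using integrable_bergman_inner(1)[OF e(1) f] by simp
  finally show ?thesis .
qed

section \<open>The orthonormal pair and the operator exchanging it\<close>

definition e\<^sub>0 :: "quat \<Rightarrow> quat" where "e\<^sub>0 = K 0"

text \<open>The factor normalises z, whose squared norm is the first moment 1 / (2 + \<alpha>). Its
  partner \<open>e\<^sub>0\<close> is the constant 1 on the disc, written as \<open>K 0\<close> so
  that inner products with it are values at 0; orthogonality is then just the vanishing of
  \<open>e\<^sub>1\<close> at 0.\<close>

definition e\<^sub>1 :: "quat \<Rightarrow> quat" where "e\<^sub>1 = extend (\<lambda>z. \<iota> (sqrt (2 + \<alpha>) *\<^sub>R z))"

definition swap :: "(quat \<Rightarrow> quat) \<Rightarrow> quat \<Rightarrow> quat" where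
  "swap f = (\<lambda>x. e\<^sub>0 x * ip e\<^sub>1 f + e\<^sub>1 x * ip e\<^sub>0 f)"

lemma e0_incl: "norm z < 1 \<Longrightarrow> e\<^sub>0 (\<iota> z) = \<iota> 1"
  by (simp add: e\<^sub>0_def K_incl kern_def)

lemma e1_incl: "norm z < 1 \<Longrightarrow> e\<^sub>1 (\<iota> z) = \<iota> (sqrt (2 + \<alpha>) *\<^sub>R z)"
  by (simp add: e\<^sub>1_def extend_incl)

lemma e0_bergman: "e\<^sub>0 \<in> B"
  by (simp add: e\<^sub>0_def K_bergman)

lemma e0_reproducing: "f \<in> B \<Longrightarrow> ip e\<^sub>0 f = f 0"
  using K_reproducing[of f 0] by (simp add: e\<^sub>0_def)

lemma e1_regular: "e\<^sub>1 \<in> slice_regular_space"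
  unfolding e\<^sub>1_def by (intro extend_regular slice_holo_incl holomorphic_intros)

lemma integral_e1:
  "integrable \<mu> (\<lambda>z. (norm (e\<^sub>1 z))\<^sup>2)" "(LINT z|\<mu>. (norm (e\<^sub>1 z))\<^sup>2) = 1"
proof -
  note [measurable] = slice_regular_borel_measurable[OF e1_regular]
  have AE: "AE z in disc_measure \<alpha>. (norm (e\<^sub>1 (\<iota> z)))\<^sup>2 = (2 + \<alpha>) * ((norm z)\<^sup>2) ^ 1"
    using AE_disc_measure by eventually_elim (use alpha in \<open>simp add: e1_incl power_mult_distrib\<close>)
  have "AE z in disc_measure \<alpha>. norm ((norm (e\<^sub>1 (\<iota> z)))\<^sup>2) \<le> 2 + \<alpha>"
    using AE AE_disc_measure
    by eventually_elim (use alpha in \<open>auto intro!: mult_left_le simp: power_le_one\<close>)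
  from finite_measure.integrable_const_bound[OF finite_measure_disc_measure[OF alpha] this]
  show "integrable \<mu> (\<lambda>z. (norm (e\<^sub>1 z))\<^sup>2)"
    by (simp add: integrable_bergman_measure)
  have "(LINT z|\<mu>. (norm (e\<^sub>1 z))\<^sup>2) = (LINT z|disc_measure \<alpha>. (norm (e\<^sub>1 (\<iota> z)))\<^sup>2)"
    by (rule integral_bergman_measure) measurable
  also have "\<dots> = (LINT z|disc_measure \<alpha>. (2 + \<alpha>) * ((norm z)\<^sup>2) ^ 1)"
    by (rule integral_cong_AE[OF _ _ AE]) measurable
  also have "\<dots> = 1"
    using disc_moment[OF alpha, of 1] alpha by (simp add: add.commute)
  finally show "(LINT z|\<mu>. (norm (e\<^sub>1 z))\<^sup>2) = 1" .
qed

lemma e1_bergman: "e\<^sub>1 \<in> B"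
  using e1_regular integral_e1(1) by (simp add: bergman_space_def)

lemma e_orthonormal: "ip e\<^sub>0 e\<^sub>0 = 1" "ip e\<^sub>1 e\<^sub>1 = 1" "ip e\<^sub>0 e\<^sub>1 = 0" "ip e\<^sub>1 e\<^sub>0 = 0"
proof -
  have at0: "e\<^sub>0 0 = 1" "e\<^sub>1 0 = 0"
    using e0_incl[of 0] e1_incl[of 0] by simp_all
  show "ip e\<^sub>0 e\<^sub>0 = 1" "ip e\<^sub>0 e\<^sub>1 = 0"
    by (simp_all add: e0_reproducing e0_bergman e1_bergman at0)
  then show "ip e\<^sub>1 e\<^sub>0 = 0"
    using inner_conj[OF e0_bergman e1_bergman] bounded_linear.linear[OF bounded_linear_qcnj, THEN linear_0]
    by simp
  show "ip e\<^sub>1 e\<^sub>1 = 1"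
    by (simp add: inner_self e1_bergman integral_e1)
qed

lemma combo_bergman: "(\<lambda>x. e\<^sub>0 x * c + e\<^sub>1 x * d) \<in> B"
  by (intro bergman_space_add bergman_space_mult e0_bergman e1_bergman)

lemma inner_combo:
  assumes "f \<in> B"
  shows "ip f (\<lambda>x. e\<^sub>0 x * c + e\<^sub>1 x * d) = ip f e\<^sub>0 * c + ip f e\<^sub>1 * d"
  using assms by (simp add: inner_add_right inner_mult_right bergman_space_mult e0_bergman e1_bergman)

lemma norm_combo: "(N (\<lambda>x. e\<^sub>0 x * c + e\<^sub>1 x * d))\<^sup>2 = (norm c)\<^sup>2 + (norm d)\<^sup>2"
proof -
  let ?h = "\<lambda>x. e\<^sub>0 x * c + e\<^sub>1 x * d"
  have "ip e\<^sub>0 ?h = c" "ip e\<^sub>1 ?h = d"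
    by (simp_all add: inner_combo e0_bergman e1_bergman e_orthonormal)
  then have "ip ?h e\<^sub>0 = qcnj c" "ip ?h e\<^sub>1 = qcnj d"
    using inner_conj[OF e0_bergman combo_bergman] inner_conj[OF e1_bergman combo_bergman] by simp_all
  then have "ip ?h ?h = of_real ((norm c)\<^sup>2 + (norm d)\<^sup>2)"
    by (simp only: inner_combo[OF combo_bergman] mult_qcnj of_real_def scaleR_add_left)
  then show ?thesis
    using inner_self_norm[OF combo_bergman, of c d] by (metis of_real_eq_iff)
qed

text \<open>Bessel's inequality for the orthonormal pair, obtained from the Cauchy-Schwarz inequality
  applied to \<open>f\<close> and its projection.\<close>

lemma norm_swap_le:
  assumes f: "f \<in> B"
  shows "N (swap f) \<le> N f"
proof -
  let ?c = "ip e\<^sub>0 f" and ?d = "ip e\<^sub>1 f"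
  let ?h = "\<lambda>x. e\<^sub>0 x * ?c + e\<^sub>1 x * ?d"
  have "ip f ?h = of_real ((norm ?c)\<^sup>2 + (norm ?d)\<^sup>2)"
    using inner_conj[OF e0_bergman f] inner_conj[OF e1_bergman f]
    by (simp only: inner_combo[OF f] mult_qcnj of_real_def scaleR_add_left)
  then have "(N ?h)\<^sup>2 = norm (ip f ?h)"
    unfolding norm_combo by (simp only: norm_of_real) simp
  also have "\<dots> \<le> N f * N ?h"
    by (rule inner_Cauchy_Schwarz[OF f combo_bergman])
  finally have "N ?h \<le> N f"
    using bergman_norm_nonneg[OF f] bergman_norm_nonneg[OF combo_bergman, of ?c ?d]
    by (cases "N ?h = 0") (auto simp: power2_eq_square)
  moreover have "(N (swap f))\<^sup>2 = (N ?h)\<^sup>2"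
    unfolding swap_def norm_combo by simp
  then have "N (swap f) = N ?h"
    using bergman_norm_nonneg[OF combo_bergman] by (simp add: swap_def)
  ultimately show ?thesis by simp
qed

lemma swap_commuting: "swap \<in> operators_commuting_J \<alpha> i"
proof -
  have "bounded_right_linear \<alpha> i swap"
    unfolding bounded_right_linear_def
  proof (intro conjI ballI allI exI[of _ 1])
    fix f g c assume f: "f \<in> B" and g: "g \<in> B"
    show "swap f \<in> B"
      unfolding swap_def by (rule combo_bergman)
    show "swap (\<lambda>x. f x + g x) = (\<lambda>x. swap f x + swap g x)"
      using f g by (simp add: swap_def inner_add_right e0_bergman e1_bergman algebra_simps)
    show "swap (\<lambda>x. f x * c) = (\<lambda>x. swap f x * c)"
      using f by (simp add: swap_def inner_mult_right e0_bergman e1_bergman distrib_right mult.assoc)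
    show "N (swap f) \<le> 1 * N f"
      using norm_swap_le[OF f] by simp
  qed
  moreover have "swap (slice_J i f) = slice_J i (swap f)" if f: "f \<in> B" for f
  proof (rule slice_J_eqI[symmetric])
    show "swap f \<in> slice_regular_space" "swap (slice_J i f) \<in> slice_regular_space"
      unfolding swap_def by (rule bergman_spaceD(1)[OF combo_bergman])+
    fix z :: complex assume z: "norm z < 1"
    have "ip e\<^sub>0 (slice_J i f) = i * ip e\<^sub>0 f" "ip e\<^sub>1 (slice_J i f) = i * ip e\<^sub>1 f"
      by (rule inner_slice_J[OF e0_bergman e0_incl f], assumption)
        (rule inner_slice_J[OF e1_bergman e1_incl f])
    then show "swap (slice_J i f) (\<iota> z) = i * swap f (\<iota> z)"
      using z by (simp add: swap_def e0_incl e1_incl distrib_left unit_incl_commute flip: mult.assoc)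
  qed
  ultimately show ?thesis by (simp add: operators_commuting_J_def)
qed

lemma swap_norm: "0 \<le> operator_norm \<alpha> i swap" "operator_norm \<alpha> i swap \<le> 1"
proof -
  have bl: "bounded_right_linear \<alpha> i swap"
    using swap_commuting by (simp add: operators_commuting_J_def)
  have "N (nk 0) = 1" "nk 0 \<in> B"
    by (simp_all add: norm_nk nk_bergman)
  then show "0 \<le> operator_norm \<alpha> i swap"
    using op_norm_upper[OF bl, of "nk 0"] bergman_norm_nonneg[OF op_bergman[OF bl, of "nk 0"]] by simp
  show "operator_norm \<alpha> i swap \<le> 1"
    unfolding operator_norm_def
  proof (rule cSUP_least)
    show "{f \<in> B. N f \<le> 1} \<noteq> {}"
      using \<open>N (nk 0) = 1\<close> \<open>nk 0 \<in> B\<close> by auto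
  qed (use norm_swap_le in force)
qed

text \<open>With s = 1 / norm of K_r, the coordinates of k_r along the pair are s and s sqrt (2 +
  \<alpha>) r, both real. The form of the exchange is twice their product, and s^2 = (1 - r^2) powr
  (2 + \<alpha>).\<close>

lemma berezin_swap:
  assumes r: "0 \<le> r" "r < 1"
  shows "berezin \<alpha> i swap (\<iota> (of_real r)) = of_real (2 * sqrt (2 + \<alpha>) * r * (1 - r\<^sup>2) powr (2 + \<alpha>))"
proof -
  let ?z = "complex_of_real r"
  have z: "norm ?z < 1" using r by simp
  let ?s = "inverse (N (K ?z))" and ?p = "sqrt (2 + \<alpha>)"
  have e: "e\<^sub>0 (\<iota> ?z) = 1" "e\<^sub>1 (\<iota> ?z) = of_real (?p * r)"
  proof -
    have "\<iota> (?p *\<^sub>R ?z) = of_real (?p * r)"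
      by (simp only: scaleR_conv_of_real of_real_mult[symmetric] incl_of_real)
    then show "e\<^sub>0 (\<iota> ?z) = 1" "e\<^sub>1 (\<iota> ?z) = of_real (?p * r)"
      by (simp_all only: e0_incl[OF z] e1_incl[OF z] incl_1)
  qed
  have "ip (nk ?z) e\<^sub>0 = of_real ?s" "ip (nk ?z) e\<^sub>1 = of_real (?s * (?p * r))"
    using z by (simp_all only: nk_reproducing e0_bergman e1_bergman e scaleR_conv_of_real of_real_mult mult_1_right)
  then have "ip e\<^sub>0 (nk ?z) = of_real ?s" "ip e\<^sub>1 (nk ?z) = of_real (?s * (?p * r))"
    using inner_conj[OF nk_bergman[OF z] e0_bergman] inner_conj[OF nk_bergman[OF z] e1_bergman]
    by (simp_all only: qcnj_of_real)
  then have "swap (nk ?z) (\<iota> ?z) = of_real (?s * (?p * r) + ?p * r * ?s)"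
    by (simp only: swap_def e mult_1_left of_real_mult of_real_add)
  moreover have "swap (nk ?z) \<in> B"
    unfolding swap_def by (rule combo_bergman)
  ultimately have "berezin \<alpha> i swap (\<iota> ?z) = of_real (?s * (?s * (?p * r) + ?p * r * ?s))"
    using z by (simp only: berezin_eq nk_reproducing scaleR_conv_of_real of_real_mult)
  also have "?s * (?s * (?p * r) + ?p * r * ?s) = 2 * ?p * r * inverse ((N (K ?z))\<^sup>2)"
    by (simp add: power2_eq_square algebra_simps)
  also have "inverse ((N (K ?z))\<^sup>2) = (1 - r\<^sup>2) powr (2 + \<alpha>)"
    unfolding norm_K_square[OF z] powr_minus by simp
  finally show ?thesis .
qed

text \<open>The transform of the exchange operator vanishes at 0, so the assumed inequality for the
  points r and 0, divided by r, compares 2 sqrt (2 + \<alpha>) (1 - r^2) powr (2 + \<alpha>) with C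
  \<beta>(r) / r. Both sides have limits as r tends to 0 from the right.\<close>

lemma Lipschitz_constant_lower:
  assumes C: "\<forall>T\<in>operators_commuting_J \<alpha> i. \<forall>z\<in>slice_disc i. \<forall>w\<in>slice_disc i.
                 norm (berezin \<alpha> i T z - berezin \<alpha> i T w)
                   \<le> C * operator_norm \<alpha> i T * bergman_metric z w"
  shows "2 * sqrt (2 + \<alpha>) \<le> C"
proof -
  define \<beta> :: "real \<Rightarrow> real" where "\<beta> r = 1 / 2 * ln ((1 + r) / (1 - r))" for r
  have ineq: "2 * sqrt (2 + \<alpha>) * (1 - r\<^sup>2) powr (2 + \<alpha>) \<le> C * (\<beta> r / r)" if r: "0 < r" "r < 1" for r
  proof -
    let ?lhs = "2 * sqrt (2 + \<alpha>) * r * (1 - r\<^sup>2) powr (2 + \<alpha>)"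
    have "(1 - r\<^sup>2) > 0" using r by (simp add: abs_square_less_1)
    then have pos: "?lhs > 0" using r alpha by simp
    have \<beta>: "bergman_metric (\<iota> (of_real r)) (\<iota> 0) = \<beta> r"
      unfolding bergman_metric_def pseudohyperbolic_incl \<beta>_def using r by simp
    have \<beta>pos: "\<beta> r > 0" using le_artanh[of r] r by (simp add: \<beta>_def)
    have b0: "berezin \<alpha> i swap (\<iota> 0) = 0"
      using berezin_swap[of 0] by simp
    have "\<iota> (of_real r) \<in> slice_disc i" "\<iota> 0 \<in> slice_disc i"
      using r by (auto simp only: slice_disc_eq intro!: imageI) auto
    then have "norm (berezin \<alpha> i swap (\<iota> (of_real r)) - berezin \<alpha> i swap (\<iota> 0))
        \<le> C * operator_norm \<alpha> i swap * bergman_metric (\<iota> (of_real r)) (\<iota> 0)"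
      using C swap_commuting by blast
    then have "?lhs \<le> C * operator_norm \<alpha> i swap * \<beta> r"
      using berezin_swap[of r] pos r unfolding \<beta> b0 by (simp only: diff_zero norm_of_real abs_of_pos less_imp_le)
    also have "\<dots> \<le> C * 1 * \<beta> r"
    proof -
      \<comment> \<open>The operator norm may be replaced by its bound 1 only if C is nonnegative; a
        negative C would contradict the positive left-hand side.\<close>
      have "C \<ge> 0"
      proof (rule ccontr)
        assume "\<not> C \<ge> 0"
        then have "C * operator_norm \<alpha> i swap * \<beta> r \<le> 0"
          using swap_norm(1) \<beta>pos by (intro mult_nonpos_nonneg) auto
        then show False using calculation pos by linarith
      qed
      then show ?thesis
        using swap_norm(2) \<beta>pos by (intro mult_right_mono mult_left_mono) auto
    qed
    finally show ?thesis using r by (simp add: field_simps)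
  qed
  \<comment> \<open>Since \<beta>(0) = 0, the quotient \<beta>(r) / r is the difference quotient of
    \<beta> at 0.\<close>
  have "(\<beta> has_real_derivative 1) (at 0)"
    unfolding \<beta>_def[abs_def] by (auto intro!: derivative_eq_intros)
  then have "((\<lambda>r. \<beta> r / r) \<longlongrightarrow> 1) (at 0)"
    by (simp add: DERIV_def \<beta>_def)
  then have "((\<lambda>r. C * (\<beta> r / r)) \<longlongrightarrow> C * 1) (at_right 0)"
    by (intro tendsto_mult_left) (rule tendsto_mono[OF at_le], auto)
  moreover have "((\<lambda>r. 2 * sqrt (2 + \<alpha>) * (1 - r\<^sup>2) powr (2 + \<alpha>)) \<longlongrightarrow> 2 * sqrt (2 + \<alpha>) * (1 - 0\<^sup>2) powr (2 + \<alpha>)) (at_right 0)"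
    by (intro tendsto_intros) auto
  moreover have "\<forall>\<^sub>F r in at_right 0. 2 * sqrt (2 + \<alpha>) * (1 - r\<^sup>2) powr (2 + \<alpha>) \<le> C * (\<beta> r / r)"
    using ineq unfolding eventually_at_right_field by (intro exI[of _ 1]) auto
  ultimately have "2 * sqrt (2 + \<alpha>) * (1 - 0\<^sup>2) powr (2 + \<alpha>) \<le> C * 1"
    by (intro tendsto_le[OF trivial_limit_at_right_real])
  then show ?thesis by simp
qed

end

theorem theorem5p20:
  fixes \<alpha> :: real and i :: quat
  assumes "\<alpha> > -1" and "i \<in> imag_units"
  shows "(\<forall>T\<in>operators_commuting_J \<alpha> i. \<forall>z\<in>slice_disc i. \<forall>w\<in>slice_disc i.
            norm (berezin \<alpha> i T z - berezin \<alpha> i T w)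
              \<le> 2 * sqrt (2 + \<alpha>) * operator_norm \<alpha> i T * bergman_metric z w)
       \<and> (\<forall>C. (\<forall>T\<in>operators_commuting_J \<alpha> i. \<forall>z\<in>slice_disc i. \<forall>w\<in>slice_disc i.
                 norm (berezin \<alpha> i T z - berezin \<alpha> i T w)
                   \<le> C * operator_norm \<alpha> i T * bergman_metric z w)
              \<longrightarrow> 2 * sqrt (2 + \<alpha>) \<le> C)"
proof -
  interpret slice_bergman i \<alpha>
    using assms by unfold_locales
  show ?thesis
    using berezin_Lipschitz Lipschitz_constant_lower by (auto simp: slice_disc_eq)
qed

end
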